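(* Let $\alpha$ be an irrational number with $0<\alpha<\tfrac12$, with nearest integer continued fraction expansion $(a_i,\varepsilon_i)$, and let $\gamma_*$ and $R=\liminf_{i\to\infty}a_i$ be as defined in the context. Then $$\rho(\alpha)\ \ge\ M(\alpha,\gamma_* )\ \ge\ \begin{cases} \dfrac{1}{2(\sqrt{13}+10)}=\dfrac{1}{27.211\ldots}, & R=2,\\[2ex] \dfrac14\,(2-\sqrt3)\,\dfrac{1-\frac14\left(1+\frac{\theta^2}{1-\theta}\right)}{1+\frac14\left(\theta-\frac{\sqrt3-1}{2}\right)}=\dfrac{1}{20.487\ldots}, \ \ \theta=\tfrac{\sqrt{13}-3}{2}, & R=3,\\[2ex] \dfrac14\left(1-\dfrac3R+\dfrac4{R^2}-\dfrac7{R^3}\right), & R\ge 4 \text{ even},\\[2ex] \dfrac14\left(1-\dfrac3R+\dfrac3{R^2}-\dfrac6{R^3}\right), & R\ge 5 \text{ odd}.\end{cases}$$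
   Context: For real $x$, $\|x\|$ is the distance from $x$ to the nearest integer and $\{x\}$ its fractional part. For irrational $\alpha$ and real $\gamma$, $M(\alpha,\gamma):=\liminf_{|n|\to\infty,\,n\in\mathbb Z}|n|\,\|n\alpha-\gamma\|$, and $\rho(\alpha):=\sup\{M(\alpha,\gamma):\gamma\in\mathbb R,\ \gamma\notin\mathbb Z+\alpha\mathbb Z\}$. Nearest integer continued fraction expansion of irrational $\alpha\in(0,\tfrac12)$: put $a_0=0$, $\varepsilon_1=1$, $\alpha_0=\alpha$, and for $i\ge0$: if $\|1/\alpha_i\|=\{1/\alpha_i\}$ set $a_{i+1}=\lfloor 1/\alpha_i\rfloor$, $\varepsilon_{i+2}=+1$; otherwise set $a_{i+1}=\lceil 1/\alpha_i\rceil$, $\varepsilon_{i+2}=-1$; in both cases $\alpha_{i+1}=\|1/\alpha_i\|$. Then $a_i\ge2$ for $i\ge1$ and $\alpha=a_0+\cfrac{\varepsilon_1}{a_1+\cfrac{\varepsilon_2}{a_2+\cdots}}$. Convergents: $p_{-1}=1,q_{-1}=0,p_0=a_0,q_0=1$, $p_i=a_ip_{i-1}+\varepsilon_ip_{i-2}$, $q_i=a_iq_{i-1}+\varepsilon_iq_{i-2}$, and $D_i:=|q_i\alpha-p_i|$ ($i\ge0$). Let $\lambda_i=0$ if $a_i$ is even and $\lambda_i=(-1)^j$ if $a_i$ is the $j$-th odd term among $a_1,a_2,\dots$ ($j=1,2,\dots$). Define $\gamma_*:=\sum_{i\ge1}\tfrac12(a_i-1+\varepsilon_i+\lambda_i)D_{i-1}$.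 Here $R:=\liminf_{i\to\infty}a_i$ (the listed cases concern finite $R$). *)

theory Defs
  imports "HOL-Analysis.Analysis"
begin

definition nint_dist :: "real \<Rightarrow> real" where
  "nint_dist x = \<bar>x - of_int (round x)\<bar>"

text \<open>The lower limit is taken in the extended reals, along the filter of integers \<open>n\<close> with
  \<open>\<bar>n\<bar> \<longrightarrow> \<infinity>\<close>.\<close>

definition inhom_M :: "real \<Rightarrow> real \<Rightarrow> ereal" where
  "inhom_M \<alpha> \<gamma> =
     Liminf (filtercomap (\<lambda>n::int. \<bar>n\<bar>) at_top)
       (\<lambda>n. ereal (\<bar>of_int n\<bar> * nint_dist (of_int n * \<alpha> - \<gamma>)))"

definition inhom_rho :: "real \<Rightarrow> ereal" where
  "inhom_rho \<alpha> =
     (SUP \<gamma> \<in> {\<gamma>. \<not> (\<exists>k l :: int. \<gamma> = of_int k + \<alpha> * of_int l)}. inhom_M \<alpha> \<gamma>)"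

primrec nicf_rem :: "real \<Rightarrow> nat \<Rightarrow> real" where
  "nicf_rem \<alpha> 0 = \<alpha>"
| "nicf_rem \<alpha> (Suc i) = nint_dist (1 / nicf_rem \<alpha> i)"

fun nicf_a :: "real \<Rightarrow> nat \<Rightarrow> int" where
  "nicf_a \<alpha> 0 = 0"
| "nicf_a \<alpha> (Suc i) =
     (if nint_dist (1 / nicf_rem \<alpha> i) = frac (1 / nicf_rem \<alpha> i)
      then \<lfloor>1 / nicf_rem \<alpha> i\<rfloor> else \<lceil>1 / nicf_rem \<alpha> i\<rceil>)"

text \<open>The signs \<open>\<epsilon>\<^sub>i\<close> are indexed by \<open>i \<ge> 1\<close>; the value at \<open>0\<close> is never used.\<close>

fun nicf_eps :: "real \<Rightarrow> nat \<Rightarrow> int" where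
  "nicf_eps \<alpha> 0 = 1"
| "nicf_eps \<alpha> (Suc 0) = 1"
| "nicf_eps \<alpha> (Suc (Suc i)) =
     (if nint_dist (1 / nicf_rem \<alpha> i) = frac (1 / nicf_rem \<alpha> i) then 1 else - 1)"

text \<open>In the equations for index \<open>1\<close> the values \<open>p\<^sub>-\<^sub>1 = 1\<close> and \<open>q\<^sub>-\<^sub>1 = 0\<close> are inserted.\<close>

fun nicf_p :: "real \<Rightarrow> nat \<Rightarrow> int" where
  "nicf_p \<alpha> 0 = nicf_a \<alpha> 0"
| "nicf_p \<alpha> (Suc 0) = nicf_a \<alpha> 1 * nicf_p \<alpha> 0 + nicf_eps \<alpha> 1 * 1"
| "nicf_p \<alpha> (Suc (Suc i)) =
     nicf_a \<alpha> (Suc (Suc i)) * nicf_p \<alpha> (Suc i) + nicf_eps \<alpha> (Suc (Suc i)) * nicf_p \<alpha> i"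

fun nicf_q :: "real \<Rightarrow> nat \<Rightarrow> int" where
  "nicf_q \<alpha> 0 = 1"
| "nicf_q \<alpha> (Suc 0) = nicf_a \<alpha> 1 * nicf_q \<alpha> 0 + nicf_eps \<alpha> 1 * 0"
| "nicf_q \<alpha> (Suc (Suc i)) =
     nicf_a \<alpha> (Suc (Suc i)) * nicf_q \<alpha> (Suc i) + nicf_eps \<alpha> (Suc (Suc i)) * nicf_q \<alpha> i"

definition nicf_D :: "real \<Rightarrow> nat \<Rightarrow> real" where
  "nicf_D \<alpha> i = \<bar>of_int (nicf_q \<alpha> i) * \<alpha> - of_int (nicf_p \<alpha> i)\<bar>"

text \<open>If \<open>a\<^sub>i\<close> is odd, the cardinality below is the position \<open>j\<close> of \<open>a\<^sub>i\<close> among the odd terms of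
  \<open>a\<^sub>1, a\<^sub>2, \<dots>\<close>.\<close>

definition nicf_lambda :: "real \<Rightarrow> nat \<Rightarrow> int" where
  "nicf_lambda \<alpha> i =
     (if even (nicf_a \<alpha> i) then 0 else (- 1) ^ card {k \<in> {1..i}. odd (nicf_a \<alpha> k)})"

definition gamma_star :: "real \<Rightarrow> real" where
  "gamma_star \<alpha> =
     (\<Sum>i. 1 / 2 * of_int (nicf_a \<alpha> (Suc i) - 1 + nicf_eps \<alpha> (Suc i) + nicf_lambda \<alpha> (Suc i))
           * nicf_D \<alpha> i)"

definition nicf_R :: "real \<Rightarrow> ereal" where
  "nicf_R \<alpha> = liminf (\<lambda>i. ereal (of_int (nicf_a \<alpha> i)))"

definition bound_two :: real where
  "bound_two = 1 / (2 * (sqrt 13 + 10))"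

definition bound_three :: real where
  "bound_three =
     (let \<theta> = (sqrt 13 - 3) / 2
      in 1 / 4 * (2 - sqrt 3) *
         ((1 - 1 / 4 * (1 + \<theta>\<^sup>2 / (1 - \<theta>))) / (1 + 1 / 4 * (\<theta> - (sqrt 3 - 1) / 2))))"

end

theory Submission
  imports Defs
begin

text \<open>
  Telescoping gives \<open>2 \<gamma>\<^sub>* = 1 + \<alpha> + \<Lambda>\<close> with \<open>\<Lambda> = \<Sum>\<^sub>i \<lambda>\<^sub>i D\<^sub>i\<^sub>-\<^sub>1\<close>, so \<open>M(\<alpha>, \<gamma>\<^sub>*)\<close> is a quarter of the lower
  limit of \<open>\<bar>N\<bar> \<bar>N \<alpha> - P - \<Lambda>\<bar>\<close> over odd \<open>N\<close>, \<open>P\<close>. Re-expressing \<open>(N, P)\<close> in terms of two consecutive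
  convergents and a partial sum of \<open>\<Lambda>\<close> keeps both coordinates odd (this is what the parity of
  \<open>\<lambda>\<^sub>i\<close> is for). The four points with coordinates \<open>\<plusminus>1\<close> lie in the four quadrants, one in each, and
  form a chain of divided cells in the sense of Barnes and Swinnerton-Dyer; concavity of the
  product along the lines joining vertices of consecutive cells shows that it suffices to bound
  the product at these vertices.

  A vertex value is a function of \<open>(\<alpha>, z)\<close>, which depends on the future digits, and of \<open>(B, Y)\<close>,
  which depends on the past ones; since the signs of \<open>\<lambda>\<^sub>i\<close> alternate, the two contributions
  of \<open>\<Lambda>\<close> have opposite signs. Both pairs are moved by projective maps, so their ranges are
  controlled by linear inequalities invariant under these maps.
\<close>

section \<open>Chains of divided cells\<close>

text \<open>Past and future are coupled: at a vertex the quantity to be bounded is a past factor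
  times a future factor over the determinant \<open>1 + al k * B k\<close>, which involves both. For
  liminf 2 or 3 the critical vertex is \<open>(1 + B - Y) * (1 - al - z)\<close>. With
  \<open>c\<close> an upper bound for \<open>al - z\<close>, the affine function
  \<open>3 - c + B\<close> is put between past and future; it is exact for a future with digit 3,
  sign -1, and then \<open>al = c\<close>, \<open>z = 0\<close>. The constant \<open>K\<close> of
  the past is fixed by making a line pass through the fixed point of the step with digit 3 and sign
  1. The other vertices are inherited, since digits 2 and 3 let consecutive cells share vertices, or
  have room to spare. The values \<open>c = 1 / 2\<close> and \<open>c = 2 - sqrt 3\<close> give the
  two constants. For liminf \<open>R\<close> at least 4 most vertices lose only about
  \<open>2 / R\<close> against 1, so past and future are estimated separately; a loss of about
  \<open>3 / R\<close> occurs only at an odd digit followed by sign -1 and an even digit, or in the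
  reverse order, and there \<open>B\<close> and \<open>Y\<close> are kept together.\<close>

lemma chain_product_bound:
  fixes p q a m w w1 w2 C :: real
  assumes a: "0 < a" and m: "\<bar>p\<bar> < m" and q: "a * m < q"
    and C1: "C \<le> (m - p) * (q + a * m)" and C2: "C \<le> (m + p) * (q - a * m)"
    and w1: "C \<le> (w1 + p) * (q - a * w1)"
    and w2: "q < a * w2" and C4: "C \<le> (w2 + p) * (a * w2 - q)"
    and w: "w \<le> - m \<or> m \<le> w \<and> w \<le> w1 \<or> w2 \<le> w"
  shows "C \<le> \<bar>(w + p) * (q - a * w)\<bar>"
proof -
  have mpos: "0 < m" using m by linarith
  have am: "0 < a * m" using a mpos by simp
  \<comment> \<open>The zeros \<open>- p\<close> and \<open>q / a\<close> of the product lie in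
    \<open>(- m, m)\<close> and in \<open>(m, w2)\<close>. On the two outer ranges both factors grow
    in modulus; on the middle range concavity is used.\<close>
  consider "w \<le> - m" | "m \<le> w" "w \<le> w1" | "w2 \<le> w" using w by blast
  then show ?thesis
  proof cases
    case 1
    have "a * w \<le> a * (- m)" using a 1 by (intro mult_left_mono) auto
    then have "(m - p) * (q + a * m) \<le> (- w - p) * (q - a * w)"
      using 1 m q am by (intro mult_mono) auto
    then have "C \<le> - ((w + p) * (q - a * w))" using C1 by (simp add: algebra_simps)
    then show ?thesis by linarith
  next
    case 2
    show ?thesis
    proof (cases "w1 = m")
      case True
      then show ?thesis using 2 C2 by simp
    next
      case False
      then have d: "0 < w1 - m" using 2 by simp
      \<comment> \<open>Linear interpolation between \<open>m\<close> and \<open>w1\<close>, plus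
        the concavity excess of a quadratic with leading coefficient \<open>- a\<close>.\<close>
      have "(w + p) * (q - a * w) * (w1 - m) =
          (w1 - w) * ((m + p) * (q - a * m)) + (w - m) * ((w1 + p) * (q - a * w1))
          + a * ((w - m) * (w1 - w) * (w1 - m))"
        by algebra
      moreover have "(w1 - w) * C \<le> (w1 - w) * ((m + p) * (q - a * m))"
        using 2 C2 by (intro mult_left_mono) auto
      moreover have "(w - m) * C \<le> (w - m) * ((w1 + p) * (q - a * w1))"
        using 2 w1 by (intro mult_left_mono) auto
      moreover have "0 \<le> a * ((w - m) * (w1 - w) * (w1 - m))" using a 2 d by simp
      moreover have "(w1 - w) * C + (w - m) * C = C * (w1 - m)" by algebra
      ultimately have "C * (w1 - m) \<le> (w + p) * (q - a * w) * (w1 - m)" by linarith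
      then have "C \<le> (w + p) * (q - a * w)" using d by simp
      then show ?thesis by linarith
    qed
  next
    case 3
    have aw: "a * w2 \<le> a * w" using a 3 by simp
    have "a * m < a * w2" using q w2 by linarith
    then have "m < w2" using a by simp
    then have "(w2 + p) * (a * w2 - q) \<le> (w + p) * (a * w - q)"
      using 3 m w2 aw by (intro mult_mono) auto
    then have "C \<le> - ((w + p) * (q - a * w))" using C4 by (simp add: algebra_simps)
    then show ?thesis by linarith
  qed
qed

text \<open>The index is shifted: \<open>n k\<close> and \<open>e k\<close> are the digit and the
  sign of index \<open>k + 1\<close>. In the application \<open>al\<close> is the remainder,
  \<open>z\<close> a rescaled tail of \<Lambda>, \<open>B k\<close> the ratio
  \<open>q (k - 1) / q k\<close> of convergent denominators with the sign \<open>e k\<close>, and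
  \<open>q k * Y k\<close> a signed sum of the denominators \<open>q (i - 1)\<close> over the odd
  digits of index \<open>i \<le> k\<close>.\<close>

locale cell_chain =
  fixes n e :: "nat \<Rightarrow> int" and al z B Y :: "nat \<Rightarrow> real"
  assumes n_ge: "2 \<le> n k"
    and e_cases: "e k = 1 \<or> e k = - 1"
    and e_two: "n k = 2 \<Longrightarrow> e (Suc k) = 1"
    and al_pos: "0 < al k" and al_less: "al k < 1 / 2"
    and al_rec: "1 / al k = n k + e (Suc k) * al (Suc k)"
    and z_odd: "odd (n k) \<Longrightarrow> z k = al k * (1 - z (Suc k))"
    and z_even: "even (n k) \<Longrightarrow> z k = al k * z (Suc k)"
    and z_nonneg: "0 \<le> z k" and z_le: "z k \<le> al k"
    and B_0: "B 0 = 0" and Y_0: "Y 0 = 0"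
    and B_Suc: "B (Suc k) = e (Suc k) / (n k + B k)"
    and Y_odd: "odd (n k) \<Longrightarrow> Y (Suc k) = e (Suc k) * (1 + Y k) / (n k + B k)"
    and Y_even: "even (n k) \<Longrightarrow> Y (Suc k) = - e (Suc k) * Y k / (n k + B k)"
begin

lemma n_odd_ge: "odd (n k) \<Longrightarrow> 3 \<le> n k"
  using n_ge[of k] by (cases "n k = 2") auto

lemma n_even_ge: "even (n k) \<Longrightarrow> n k \<noteq> 2 \<Longrightarrow> 4 \<le> n k"
  using n_ge[of k] by (cases "n k = 3") auto

lemma e_real: "real_of_int (e k) = 1 \<or> real_of_int (e k) = - 1"
  using e_cases[of k] by auto

text \<open>At a vertex this gives \<open>w + v * B k + Y k\<close> the sign of \<open>w\<close>,
  one half of the statement about quadrants; \<open>0 \<le> z k \<le> al k < 1 / 2\<close> gives the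
  other half. The induction closes because an odd digit, the only kind that adds 1 to
  \<open>Y\<close>, is at least 3.\<close>

lemma abs_B_Y: "\<bar>B k\<bar> + \<bar>Y k\<bar> < 1"
proof (induction k)
  case 0
  then show ?case by (simp add: B_0 Y_0)
next
  case (Suc k)
  have n2: "2 \<le> real_of_int (n k)" using n_ge[of k] by simp
  have D: "0 < n k + B k" using Suc n2 by linarith
  have "\<bar>B (Suc k)\<bar> = 1 / (n k + B k)"
    using D e_real[of "Suc k"] by (auto simp: B_Suc)
  moreover have "\<bar>Y (Suc k)\<bar> * (n k + B k) < n k + B k - 1"
  proof (cases "odd (n k)")
    case True
    have "\<bar>Y (Suc k)\<bar> = \<bar>1 + Y k\<bar> / (n k + B k)"
      using D e_real[of "Suc k"] by (auto simp: Y_odd[OF True] abs_mult)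
    then have "\<bar>Y (Suc k)\<bar> * (n k + B k) = \<bar>1 + Y k\<bar>" using D by simp
    moreover have "3 \<le> real_of_int (n k)" using n_odd_ge[OF True] by simp
    ultimately show ?thesis using Suc by linarith
  next
    case False
    have "\<bar>Y (Suc k)\<bar> = \<bar>Y k\<bar> / (n k + B k)"
      using D e_real[of "Suc k"] False by (auto simp: Y_even abs_mult)
    then have "\<bar>Y (Suc k)\<bar> * (n k + B k) = \<bar>Y k\<bar>" using D by simp
    then show ?thesis using Suc n2 by linarith
  qed
  then have "\<bar>Y (Suc k)\<bar> < (n k + B k - 1) / (n k + B k)" using D by (simp add: field_simps)
  moreover have "(n k + B k - 1) / (n k + B k) = 1 - 1 / (n k + B k)"
    using D by (simp add: field_simps)
  ultimately show ?case by linarith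
qed

lemma B_bounds: "- 1 < B k" "B k < 1"
  using abs_B_Y[of k] by linarith+

lemma den_gt_one: "1 < n k + B k"
  using n_ge[of k] B_bounds(1)[of k] by linarith

lemma al_B_pos: "0 < 1 + al k * B k"
proof -
  have "\<bar>al k * B k\<bar> \<le> 1 / 2 * 1"
    unfolding abs_mult using al_pos[of k] al_less[of k] B_bounds[of k] by (intro mult_mono) auto
  then show ?thesis by linarith
qed

lemma den_mult_B: "(n k + B k) * B (Suc k) = e (Suc k)"
  using den_gt_one[of k] by (simp add: B_Suc)

lemma den_mult_Y_odd: "odd (n k) \<Longrightarrow> (n k + B k) * Y (Suc k) = e (Suc k) * (1 + Y k)"
  using den_gt_one[of k] by (simp add: Y_odd)

lemma den_mult_Y_even: "even (n k) \<Longrightarrow> (n k + B k) * Y (Suc k) = - e (Suc k) * Y k"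
  using den_gt_one[of k] by (simp add: Y_even)

lemma al_mult_den: "al k * (n k + e (Suc k) * al (Suc k)) = 1"
  using al_rec[of k] al_pos[of k] by (simp add: field_simps)

lemma e_mult_den: "e (Suc k) * B (Suc k) * (n k + B k) = 1"
  using den_gt_one[of k] e_real[of "Suc k"] by (auto simp: B_Suc)

text \<open>\<open>1 + al k * B k\<close> is the determinant of the linear parts of the two forms.
  The passage to the next level is unimodular and takes the factors \<open>n k + B k\<close> and
  \<open>al k\<close> out of the forms.\<close>

lemma al_B_Suc: "al k * (n k + B k) * (1 + al (Suc k) * B (Suc k)) = 1 + al k * B k"
proof -
  have "al k * (n k + B k) * (1 + al (Suc k) * B (Suc k)) =
      al k * (n k + B k) + al k * al (Suc k) * ((n k + B k) * B (Suc k))"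
    by (simp add: algebra_simps)
  also have "\<dots> = al k * (n k + e (Suc k) * al (Suc k)) + al k * B k"
    unfolding den_mult_B by (simp add: algebra_simps)
  finally show ?thesis by (simp add: al_mult_den)
qed

text \<open>The cell at level \<open>k\<close> has the vertices \<open>(w, v) \<in> {1, -1}\<^sup>2\<close>; \<open>r\<close> is the
  product of the signs of \<open>w\<close> and \<open>v\<close>, and \<open>s\<close> the sign of \<open>w\<close>.\<close>

definition vertices_ge :: "real \<Rightarrow> nat \<Rightarrow> bool" where
  "vertices_ge T k \<longleftrightarrow> (\<forall>r\<in>{1, - 1}. \<forall>s\<in>{1, - 1}.
     T * (1 + al k * B k) \<le> (1 + r * B k + s * Y k) * (1 - r * al k + r * s * z k))"

text \<open>The descent also meets points with \<open>\<bar>w\<bar> = \<bar>v\<bar> = m > 1\<close>.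
  The offsets \<open>Y\<close> and \<open>z\<close> do not scale with \<open>m\<close>, but the
  linear parts \<open>1 + r * B k\<close> and \<open>1 - r * al k\<close> are positive, so both
  factors only grow.\<close>

lemma vertices_ge_scaled:
  assumes "vertices_ge T k" and m: "1 \<le> m" and r: "r = 1 \<or> r = - 1" and s: "s = 1 \<or> s = - 1"
  shows "T * (1 + al k * B k) \<le> (m * (1 + r * B k) + s * Y k) * (m * (1 - r * al k) + r * s * z k)"
    and "0 < m * (1 + r * B k) + s * Y k" and "0 < m * (1 - r * al k) + r * s * z k"
proof -
  have "(m - 1) * (1 + r * B k) \<ge> 0" using r m B_bounds[of k] by auto
  moreover have "(m - 1) * (1 - r * al k) \<ge> 0" using r m al_pos[of k] al_less[of k] by auto
  ultimately have 1: "1 + r * B k + s * Y k \<le> m * (1 + r * B k) + s * Y k"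
    and 2: "1 - r * al k + r * s * z k \<le> m * (1 - r * al k) + r * s * z k"
    by (auto simp: algebra_simps)
  have p1: "0 < 1 + r * B k + s * Y k" using r s abs_B_Y[of k] by auto
  have p2: "0 < 1 - r * al k + r * s * z k"
    using r s al_pos[of k] al_less[of k] z_nonneg[of k] z_le[of k] by auto
  show "0 < m * (1 + r * B k) + s * Y k" "0 < m * (1 - r * al k) + r * s * z k"
    using 1 2 p1 p2 by linarith+
  have "T * (1 + al k * B k) \<le> (1 + r * B k + s * Y k) * (1 - r * al k + r * s * z k)"
    using assms unfolding vertices_ge_def by blast
  also have "\<dots> \<le> (m * (1 + r * B k) + s * Y k) * (m * (1 - r * al k) + r * s * z k)"
    using 1 2 p1 p2 by (intro mult_mono) auto
  finally show "T * (1 + al k * B k) \<le> (m * (1 + r * B k) + s * Y k) * (m * (1 - r * al k) + r * s * z k)" .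
qed

definition odd_part :: "nat \<Rightarrow> int" where
  "odd_part k = (if odd (n k) then 1 else 0)"

text \<open>A point of the lattice coset has odd integral coordinates \<open>(w, v)\<close> at every level; \<open>L1\<close> and
  \<open>L2\<close> are, up to factors depending only on \<open>k\<close>, its two real coordinates.\<close>

definition L1 :: "nat \<Rightarrow> int \<Rightarrow> int \<Rightarrow> real" where
  "L1 k w v = w + v * B k + Y k"

definition L2 :: "nat \<Rightarrow> int \<Rightarrow> int \<Rightarrow> real" where
  "L2 k w v = v - al k * w + z k"

text \<open>Coordinates with respect to the next pair of convergents. The shift by 1 in
  \<open>nxt_v\<close> at odd digits preserves oddness of both coordinates; the overall sign depends
  on the parity of the digit so that the offset of \<open>L2\<close> is again \<open>+ z\<close> and
  not \<open>- z\<close>.\<close>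

definition nxt_w :: "nat \<Rightarrow> int \<Rightarrow> int" where
  "nxt_w k v = (if odd (n k) then e (Suc k) * v else - e (Suc k) * v)"

definition nxt_v :: "nat \<Rightarrow> int \<Rightarrow> int \<Rightarrow> int" where
  "nxt_v k w v = (if odd (n k) then w - n k * v - 1 else n k * v - w)"

lemma L1_nxt: "(n k + B k) * \<bar>L1 (Suc k) (nxt_w k v) (nxt_v k w v)\<bar> = \<bar>L1 k w v\<bar>"
proof -
  have D: "0 < n k + B k" using den_gt_one[of k] by linarith
  have "(n k + B k) * L1 (Suc k) w' v' = (n k + B k) * w' + real_of_int v' * real_of_int (e (Suc k))
      + (n k + B k) * Y (Suc k)" for w' v'
    unfolding den_mult_B[of k, symmetric] by (simp add: L1_def algebra_simps)
  then have "(n k + B k) * L1 (Suc k) (nxt_w k v) (nxt_v k w v) =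
      (if odd (n k) then e (Suc k) else - e (Suc k)) * L1 k w v"
    using den_mult_Y_odd[of k] den_mult_Y_even[of k]
    by (auto simp: L1_def[of k] nxt_w_def nxt_v_def algebra_simps)
  then have "\<bar>(n k + B k) * L1 (Suc k) (nxt_w k v) (nxt_v k w v)\<bar> = \<bar>L1 k w v\<bar>"
    using e_real[of "Suc k"] by (auto simp: abs_mult)
  then show ?thesis using D by (simp add: abs_mult)
qed

lemma L2_nxt: "al k * \<bar>L2 (Suc k) (nxt_w k v) (nxt_v k w v)\<bar> = \<bar>L2 k w v\<bar>"
proof -
  have "al k * L2 (Suc k) (nxt_w k v) (nxt_v k w v) = (if odd (n k) then - 1 else 1) * L2 k w v"
  proof (cases "odd (n k)")
    case True
    have "al k * L2 (Suc k) (nxt_w k v) (nxt_v k w v) =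
      al k * w - v * (al k * (n k + e (Suc k) * al (Suc k))) - al k * (1 - z (Suc k))"
      using True by (simp add: L2_def nxt_w_def nxt_v_def algebra_simps)
    then show ?thesis using True by (simp only: al_mult_den) (simp add: L2_def z_odd)
  next
    case False
    have "al k * L2 (Suc k) (nxt_w k v) (nxt_v k w v) =
      - al k * w + v * (al k * (n k + e (Suc k) * al (Suc k))) + al k * z (Suc k)"
      using False by (simp add: L2_def nxt_w_def nxt_v_def algebra_simps)
    then show ?thesis using False by (simp only: al_mult_den) (simp add: L2_def z_even)
  qed
  then have "\<bar>al k * L2 (Suc k) (nxt_w k v) (nxt_v k w v)\<bar> = \<bar>L2 k w v\<bar>"
    by (auto simp: abs_mult)
  then show ?thesis using al_pos[of k] by (simp add: abs_mult)
qed

text \<open>The product of the forms and the determinant lose the same factor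
  \<open>al k * (n k + B k)\<close>, so the inequality does not depend on the level at which a point
  is described.\<close>

lemma product_nxt_iff:
  "T * (1 + al (Suc k) * B (Suc k)) \<le> \<bar>L1 (Suc k) (nxt_w k v) (nxt_v k w v)\<bar> * \<bar>L2 (Suc k) (nxt_w k v) (nxt_v k w v)\<bar>
   \<longleftrightarrow> T * (1 + al k * B k) \<le> \<bar>L1 k w v\<bar> * \<bar>L2 k w v\<bar>" (is "?a \<le> ?b \<longleftrightarrow> ?c \<le> ?d")
proof -
  have p: "0 < al k * (n k + B k)" using den_gt_one[of k] al_pos[of k] by simp
  have c: "?c = al k * (n k + B k) * ?a" unfolding al_B_Suc[of k, symmetric] by simp
  have d: "?d = al k * (n k + B k) * ?b" unfolding L1_nxt[of k v w,symmetric] L2_nxt[of k v w,symmetric]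
    by simp
  show ?thesis unfolding c d using mult_le_cancel_left_pos[OF p] by blast
qed

lemma odd_nxt: "odd w \<Longrightarrow> odd v \<Longrightarrow> odd (nxt_w k v) \<and> odd (nxt_v k w v)"
  using e_cases[of "Suc k"] by (auto simp: nxt_w_def nxt_v_def)

lemma abs_nxt_w: "\<bar>nxt_w k v\<bar> = \<bar>v\<bar>"
  using e_cases[of "Suc k"] by (auto simp: nxt_w_def abs_mult)

lemma abs_nxt_v: "\<bar>nxt_v k w v\<bar> = \<bar>w - n k * v - odd_part k\<bar>"
  by (auto simp: nxt_v_def odd_part_def)

text \<open>On the line \<open>v = s * m\<close> with \<open>s\<close> a sign, the points with
  \<open>\<bar>nxt_v\<bar> = m\<close> have \<open>s * w = n k * m + s * odd_part k + r * m\<close>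
  for \<open>r = 1\<close> and \<open>r = - 1\<close>. At the next level both of their coordinates
  have modulus \<open>m\<close>; \<open>s'\<close> accounts for the sign change at odd
  digits.\<close>

lemma next_vertex_L1:
  fixes m s r s' :: real and k :: nat
  defines "s' \<equiv> (if odd (n k) then - s else s)"
  shows "n k * m + s * odd_part k + r * m + (m * B k + s * Y k) =
    (n k + B k) * (m * (1 + r * e (Suc k) * B (Suc k)) - s' * e (Suc k) * Y (Suc k))"
proof -
  have E: "real_of_int (e (Suc k)) * e (Suc k) = 1" using e_real[of "Suc k"] by auto
  have "(n k + B k) * (m * (1 + r * e (Suc k) * B (Suc k)) - s' * e (Suc k) * Y (Suc k)) =
    m * (n k + B k) + m * r * e (Suc k) * ((n k + B k) * B (Suc k))
      - s' * e (Suc k) * ((n k + B k) * Y (Suc k))"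
    by (simp add: algebra_simps)
  also have "\<dots> = m * (n k + B k) + m * r * (real_of_int (e (Suc k)) * real_of_int (e (Suc k)))
      - s' * e (Suc k) * ((n k + B k) * Y (Suc k))"
    unfolding den_mult_B by simp
  also have "s' * e (Suc k) * ((n k + B k) * Y (Suc k)) =
     (real_of_int (e (Suc k)) * real_of_int (e (Suc k))) * (- s * (odd_part k + Y k))"
    by (auto simp: s'_def odd_part_def den_mult_Y_odd den_mult_Y_even)
  finally show ?thesis unfolding E by (simp add: algebra_simps)
qed

lemma next_vertex_L2:
  fixes m s r s' :: real and k :: nat
  defines "s' \<equiv> (if odd (n k) then - s else s)"
  shows "m + s * z k - al k * (n k * m + s * odd_part k + r * m) =
    al k * (m * (- r + e (Suc k) * al (Suc k)) + s' * z (Suc k))"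
proof -
  have "m = m * (al k * (n k + e (Suc k) * al (Suc k)))" by (simp add: al_mult_den)
  moreover have "s * z k = al k * (s * odd_part k + s' * z (Suc k))"
    by (auto simp: s'_def odd_part_def z_odd z_even algebra_simps)
  ultimately show ?thesis by (simp add: algebra_simps)
qed

text \<open>For fixed \<open>v\<close> the product of the two linear forms is concave in \<open>w\<close> between its zeros;
  the points with \<open>\<bar>w\<bar> = \<bar>v\<bar>\<close> are multiples of vertices at level \<open>k\<close>, those with
  \<open>\<bar>nxt_v k w v\<bar> = \<bar>v\<bar>\<close> multiples of vertices at level \<open>k + 1\<close>.\<close>

lemma product_ge_of_local_min:
  assumes k: "vertices_ge T k" and Suc: "vertices_ge T (Suc k)"
    and v: "v \<noteq> 0" and vw: "\<bar>v\<bar> \<le> \<bar>w\<bar>" and vn: "\<bar>v\<bar> \<le> \<bar>nxt_v k w v\<bar>"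
  shows "T * (1 + al k * B k) \<le> \<bar>L1 k w v\<bar> * \<bar>L2 k w v\<bar>"
proof -
  define m :: real where "m = \<bar>v\<bar>"
  define s :: real where "s = sgn v"
  define s' where "s' = (if odd (n k) then - s else s)"
  define E :: real where "E = e (Suc k)"
  \<comment> \<open>After multiplication by \<open>s\<close> the line becomes \<open>v = m\<close>;
    \<open>w1\<close> and \<open>w2\<close> are the two places on it where \<open>nxt_v\<close> has
    modulus \<open>m\<close>.\<close>
  define w1 where "w1 = n k * m + s * odd_part k + (- 1) * m"
  define w2 where "w2 = n k * m + s * odd_part k + 1 * m"
  have m: "1 \<le> m" using v unfolding m_def by linarith
  have s: "s = 1 \<or> s = - 1" using v by (auto simp: s_def sgn_if)
  have s': "s' = 1 \<or> s' = - 1" using s by (auto simp: s'_def)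
  have E: "E = 1 \<or> E = - 1" using e_real by (simp add: E_def)
  have sv: "s * v = m" by (auto simp: s_def m_def sgn_if abs_if)
  have al: "0 < al k" by (rule al_pos)
  have D: "0 < n k + B k" using den_gt_one[of k] by linarith
  have CS: "T * (1 + al k * B k) = (al k * (n k + B k)) * (T * (1 + al (Suc k) * B (Suc k)))"
    using al_B_Suc[of k] by (metis (no_types, opaque_lifting) mult.left_commute)
  have ge: "0 \<le> al k * (n k + B k)" using al D by simp
  have s'E: "- s' * E = 1 \<or> - s' * E = - 1" using s' E by auto
  have mE: "- E = 1 \<or> - E = - 1" using E by auto
  have EE: "E * E = 1" using E by auto
  have L1w1: "w1 + (m * B k + s * Y k) = (n k + B k) * (m * (1 + - E * B (Suc k)) + - s' * E * Y (Suc k))"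
    unfolding w1_def next_vertex_L1 s'_def E_def by simp
  have L1w2: "w2 + (m * B k + s * Y k) = (n k + B k) * (m * (1 + E * B (Suc k)) + - s' * E * Y (Suc k))"
    unfolding w2_def next_vertex_L1 s'_def E_def by simp
  have L2w1: "m + s * z k - al k * w1 = al k * (m * (1 - (- E) * al (Suc k)) + (- E) * (- s' * E) * z (Suc k))"
    unfolding w1_def next_vertex_L2 s'_def E_def[symmetric] using EE by (simp add: algebra_simps)
  have L2w2: "al k * w2 - (m + s * z k) = al k * (m * (1 - E * al (Suc k)) + E * (- s' * E) * z (Suc k))"
  proof -
    have "E * (- s' * E) = - s'" using EE by (simp add: algebra_simps)
    then show ?thesis
      using next_vertex_L2[of m s k 1] unfolding w2_def s'_def E_def[symmetric]
      by (simp add: algebra_simps split: if_splits)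
  qed
  note g1 = vertices_ge_scaled[OF Suc m mE s'E]
  note g2 = vertices_ge_scaled[OF Suc m E s'E]
  have ms: "s = - 1 \<or> s = 1" using s by auto
  note g3 = vertices_ge_scaled[OF k m, of "- 1" "- s", simplified, OF ms]
  note g4 = vertices_ge_scaled[OF k m, of 1 s, simplified, OF s]
  have "T * (1 + al k * B k) \<le> \<bar>(s * w + (m * B k + s * Y k)) * ((m + s * z k) - al k * (s * w))\<bar>"
  proof (rule chain_product_bound[OF al, where m = m and ?w1.0 = w1 and ?w2.0 = w2])
    show "\<bar>m * B k + s * Y k\<bar> < m" using g3(2) g4(2) by (auto simp: algebra_simps abs_if)
    show "al k * m < m + s * z k" using g4(3) by (simp add: algebra_simps)
    show "T * (1 + al k * B k) \<le> (m - (m * B k + s * Y k)) * (m + s * z k + al k * m)"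
      using g3(1) by (simp add: algebra_simps)
    show "T * (1 + al k * B k) \<le> (m + (m * B k + s * Y k)) * (m + s * z k - al k * m)"
      using g4(1) by (simp add: algebra_simps)
    show "T * (1 + al k * B k) \<le> (w1 + (m * B k + s * Y k)) * (m + s * z k - al k * w1)"
      unfolding L1w1 L2w1 CS using mult_left_mono[OF g1(1) ge] by (simp add: mult_ac)
    show "m + s * z k < al k * w2"
      using mult_pos_pos[OF al g2(3)] L2w2 by linarith
    show "T * (1 + al k * B k) \<le> (w2 + (m * B k + s * Y k)) * (al k * w2 - (m + s * z k))"
      unfolding L1w2 L2w2 CS using mult_left_mono[OF g2(1) ge] by (simp add: mult_ac)
    \<comment> \<open>\<open>vw\<close> excludes the open interval \<open>(- m, m)\<close> and
      \<open>vn\<close> the open interval \<open>(w1, w2)\<close>; exactly the three ranges of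
      \<open>chain_product_bound\<close> remain.\<close>
    have "m \<le> \<bar>s * w\<bar>" using vw s unfolding m_def by (auto simp: abs_mult)
    moreover have "m \<le> \<bar>s * w - n k * m - s * odd_part k\<bar>"
    proof -
      have "s * w - n k * m - s * odd_part k = s * (w - n k * v - odd_part k)"
        unfolding sv[symmetric] by (simp add: algebra_simps)
      then have "\<bar>s * w - n k * m - s * odd_part k\<bar> = \<bar>real_of_int (w - n k * v - odd_part k)\<bar>"
        using s by (auto simp: abs_mult)
      then show ?thesis using vn unfolding abs_nxt_v m_def by linarith
    qed
    ultimately show "s * w \<le> - m \<or> m \<le> s * w \<and> s * w \<le> w1 \<or> w2 \<le> s * w"
      unfolding w1_def w2_def using m by linarith
  qed
  also have "s * w + (m * B k + s * Y k) = s * L1 k w v"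
    unfolding L1_def sv[symmetric] by (simp add: algebra_simps)
  also have "m + s * z k - al k * (s * w) = s * L2 k w v"
    unfolding L2_def sv[symmetric] by (simp add: algebra_simps)
  also have "\<bar>s * L1 k w v * (s * L2 k w v)\<bar> = \<bar>L1 k w v\<bar> * \<bar>L2 k w v\<bar>"
    using s by (auto simp: abs_mult)
  finally show ?thesis .
qed

text \<open>Descent on \<open>\<bar>v\<bar>\<close>: if the next second coordinate is smaller, then,
  since \<open>\<bar>nxt_w k v\<bar> = \<bar>v\<bar>\<close>, the point satisfies the same
  hypothesis one level later. Otherwise the point is settled between two consecutive cells.\<close>

lemma product_ge_of_abs_le:
  assumes V: "\<And>k. k \<ge> K \<Longrightarrow> vertices_ge T k"
  shows "k \<ge> K \<Longrightarrow> odd w \<Longrightarrow> odd v \<Longrightarrow> \<bar>v\<bar> \<le> \<bar>w\<bar>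
    \<Longrightarrow> T * (1 + al k * B k) \<le> \<bar>L1 k w v\<bar> * \<bar>L2 k w v\<bar>"
proof (induction "nat \<bar>v\<bar>" arbitrary: k w v rule: less_induct)
  case less
  have v0: "v \<noteq> 0" using less.prems by auto
  show ?case
  proof (cases "\<bar>v\<bar> \<le> \<bar>nxt_v k w v\<bar>")
    case True
    then show ?thesis
      using product_ge_of_local_min[OF V V v0] less.prems by auto
  next
    case False
    then have "nat \<bar>nxt_v k w v\<bar> < nat \<bar>v\<bar>" by linarith
    moreover have "\<bar>nxt_v k w v\<bar> \<le> \<bar>nxt_w k v\<bar>" using False by (simp add: abs_nxt_w)
    ultimately show ?thesis
      using less.hyps[of "nxt_v k w v" "Suc k" "nxt_w k v"] odd_nxt less.prems
      unfolding product_nxt_iff by auto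
  qed
qed

text \<open>Smallness of \<open>L2\<close> at level \<open>K\<close> forces \<open>\<bar>v\<bar> \<le> \<bar>w\<bar>\<close> there.\<close>

theorem product_ge_of_vertices_ge:
  assumes V: "\<And>k. k \<ge> K \<Longrightarrow> vertices_ge T k"
  shows "\<exists>c>0. \<forall>w v. odd w \<longrightarrow> odd v \<longrightarrow> \<bar>v - al 0 * w + z 0\<bar> < c
      \<longrightarrow> T \<le> \<bar>w\<bar> * \<bar>v - al 0 * w + z 0\<bar>"
proof -
  have "\<exists>c::real>0. \<forall>w v. odd w \<longrightarrow> odd v \<longrightarrow> \<bar>L2 j w v\<bar> < c
      \<longrightarrow> T * (1 + al j * B j) \<le> \<bar>L1 j w v\<bar> * \<bar>L2 j w v\<bar>" if "j \<le> K" for j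
    using that
  proof (induction rule: inc_induct)
    case base
    \<comment> \<open>The threshold 1 works because it gives
      \<open>\<bar>v\<bar> < \<bar>w\<bar> / 2 + 3 / 2\<close>, which is at most
      \<open>\<bar>w\<bar> + 1\<close> for odd \<open>w\<close>.\<close>
    have "T * (1 + al K * B K) \<le> \<bar>L1 K w v\<bar> * \<bar>L2 K w v\<bar>"
      if "odd w" "odd v" "\<bar>L2 K w v\<bar> < 1" for w v
    proof -
      have "\<bar>al K * w\<bar> \<le> 1 / 2 * \<bar>w\<bar>"
        using al_pos[of K] al_less[of K] mult_right_mono[of "al K" "1 / 2" "\<bar>real_of_int w\<bar>"]
        by (simp add: abs_mult)
      moreover have "1 \<le> \<bar>w\<bar>" using that(1) by (cases "w = 0") auto
      ultimately have "real_of_int \<bar>v\<bar> < \<bar>w\<bar> + 1"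
        using that(3) z_nonneg[of K] z_le[of K] al_less[of K] unfolding L2_def by linarith
      then have "\<bar>v\<bar> \<le> \<bar>w\<bar>" by linarith
      then show ?thesis using product_ge_of_abs_le[OF V, of K K w v] that by auto
    qed
    then show ?case by (intro exI[of _ 1]) auto
  next
    case (step j)
    then obtain c where c: "0 < c" and ge: "\<And>w v. odd w \<Longrightarrow> odd v \<Longrightarrow> \<bar>L2 (Suc j) w v\<bar> < c
      \<Longrightarrow> T * (1 + al (Suc j) * B (Suc j)) \<le> \<bar>L1 (Suc j) w v\<bar> * \<bar>L2 (Suc j) w v\<bar>"
      by blast
    have "T * (1 + al j * B j) \<le> \<bar>L1 j w v\<bar> * \<bar>L2 j w v\<bar>"
      if "odd w" "odd v" "\<bar>L2 j w v\<bar> < al j * c" for w v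
    proof -
      have "al j * \<bar>L2 (Suc j) (nxt_w j v) (nxt_v j w v)\<bar> < al j * c"
        using that(3) by (simp only: L2_nxt)
      then have "\<bar>L2 (Suc j) (nxt_w j v) (nxt_v j w v)\<bar> < c" using al_pos[of j] by simp
      then show ?thesis using ge odd_nxt[OF that(1,2)] product_nxt_iff[of T j v w] by blast
    qed
    then show ?case using c al_pos[of j] by (intro exI[of _ "al j * c"]) auto
  qed
  from this[of 0] show ?thesis by (simp add: L1_def L2_def B_0 Y_0)
qed

end

section \<open>Vertices for small partial quotients\<close>

definition theta :: real where "theta = (sqrt 13 - 3) / 2"

lemma theta_sq: "theta * theta = 1 - 3 * theta"
  by (simp add: theta_def field_simps)

lemma theta_bounds: "0 < theta" "3 * theta < 1"
proof -
  have "3 < sqrt 13" by (rule real_less_rsqrt) simp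
  then show "0 < theta" by (simp add: theta_def)
  then show "3 * theta < 1" using theta_sq mult_pos_pos[of theta theta] by linarith
qed

context cell_chain
begin

text \<open>\<open>(n k + B k) * B (Suc k)\<close> is a sign and
  \<open>(n k + B k) * Y (Suc k)\<close> is affine in \<open>Y k\<close>; a linear inequality at
  level \<open>Suc k\<close> thus pulls back to a linear one at level \<open>k\<close>.\<close>

lemma linear_Suc:
  fixes c0 c1 c2 :: real
  assumes "c1 * ((n k + B k) * Y (Suc k)) \<le> c0 * (n k + B k) + c2 * e (Suc k)"
  shows "c1 * Y (Suc k) \<le> c0 + c2 * B (Suc k)"
proof -
  have "(n k + B k) * (c1 * Y (Suc k)) \<le> (n k + B k) * c0 + c2 * ((n k + B k) * B (Suc k))"
    unfolding den_mult_B using assms by (simp add: algebra_simps)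
  then have "(n k + B k) * (c1 * Y (Suc k)) \<le> (n k + B k) * (c0 + c2 * B (Suc k))"
    by (simp add: algebra_simps)
  then show ?thesis using den_gt_one[of k] by simp
qed

text \<open>The lines \<open>3 Y = 1 + B\<close>, \<open>12 Y = 4 + \<theta> + 3 B\<close> and \<open>12 Y = 3 + 3 \<theta> + (4 + \<theta>) B\<close> all pass
  through the fixed point \<open>(\<theta>, (1 + \<theta>) / 3)\<close> of the step with \<open>n = 3\<close>, \<open>e = 1\<close>. That step maps
  the first line to itself, the third to the second, and a line whose slope is between those of
  the first two to the third.\<close>

lemma Y_bounds_conj:
  "- 1 / 2 \<le> Y k \<and> 3 * Y k \<le> 1 + B k \<and> 12 * Y k \<le> 4 + theta + 3 * B k
   \<and> 12 * Y k \<le> 3 + 3 * theta + (4 + theta) * B k"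
proof (induction k)
  case 0
  then show ?case using theta_bounds by (simp add: B_0 Y_0)
next
  case (Suc k)
  then have IH: "- 1 / 2 \<le> Y k" "3 * Y k \<le> 1 + B k" "12 * Y k \<le> 4 + theta + 3 * B k"
    "12 * Y k \<le> 3 + 3 * theta + (4 + theta) * B k" by auto
  note bds = B_bounds[of k] abs_B_Y[of k] theta_bounds
  have tB: "- theta < theta * B k" "theta * B k < theta"
    using bds mult_strict_left_mono[of "- 1" "B k" theta] mult_strict_left_mono[of "B k" 1 theta]
    by auto
  \<comment> \<open>The pullback of the fourth inequality under digit 3 with sign 1, obtained as the
    convex combination of the second and third with weights \<open>3 * theta\<close> and
    \<open>1 - 3 * theta\<close>.\<close>
  have comb: "12 * Y k \<le> 1 + 10 * theta + 3 * B k + 3 * (theta * B k)"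
  proof -
    have "0 \<le> (3 * theta) * (4 + 4 * B k - 12 * Y k) + (1 - 3 * theta) * (4 + theta + 3 * B k - 12 * Y k)"
      using IH bds by (intro add_nonneg_nonneg mult_nonneg_nonneg) auto
    also have "(3 * theta) * (4 + 4 * B k - 12 * Y k) + (1 - 3 * theta) * (4 + theta + 3 * B k - 12 * Y k)
      = 4 + theta + 3 * B k + 3 * (theta * B k) - 12 * Y k - 3 * (theta * theta)"
      by (simp add: algebra_simps)
    finally show ?thesis unfolding theta_sq by (simp add: algebra_simps)
  qed
  \<comment> \<open>The products with \<open>theta\<close> are named so that every remaining goal is
    linear in its atoms.\<close>
  define D E W tD tE tB where defs: "D = n k + B k" "E = real_of_int (e (Suc k))"
    "W = (n k + B k) * Y (Suc k)" "tD = theta * D" "tE = theta * E" "tB = theta * B k"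
  have IH4: "12 * Y k \<le> 3 + 3 * theta + 4 * B k + tB" using IH(4) by (simp add: defs algebra_simps)
  have tn: "theta * x + tB \<le> tD" if "x \<le> n k" for x :: real
    using mult_left_mono[OF that, of theta] bds by (simp add: defs algebra_simps)
  have "- W \<le> D / 2 \<and> 3 * W \<le> D + E \<and> 12 * W \<le> 4 * D + tD + 3 * E
      \<and> 12 * W \<le> 3 * D + 3 * tD + 4 * E + tE"
  proof (cases "odd (n k)")
    case True
    then have W: "W = E * (1 + Y k)" by (simp add: defs den_mult_Y_odd)
    have D: "3 + B k \<le> D" using n_odd_ge[OF True] by (simp add: defs)
    have tD: "3 * theta + tB \<le> tD" using tn[of 3] n_odd_ge[OF True] by simp
    from e_real[of "Suc k"] show ?thesis
    proof
      assume "real_of_int (e (Suc k)) = 1"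
      then have E: "E = 1" "tE = theta" "W = 1 + Y k" by (simp_all add: defs W[unfolded defs])
      show ?thesis unfolding E using IH(1-3) IH4 bds tB comb D tD unfolding defs(6)[symmetric]
        by (intro conjI; argo)
    next
      assume "real_of_int (e (Suc k)) = - 1"
      then have E: "E = - 1" "tE = - theta" "W = - 1 - Y k" by (simp_all add: defs W[unfolded defs])
      show ?thesis unfolding E using IH(1-3) IH4 bds tB D tD unfolding defs(6)[symmetric]
        by (intro conjI; argo)
    qed
  next
    case False
    then have W: "W = - E * Y k" by (simp add: defs den_mult_Y_even)
    show ?thesis
    proof (cases "e (Suc k) = 1")
      case True
      then have E: "E = 1" "tE = theta" "W = - Y k" using W by (simp_all add: defs)
      have D: "2 + B k \<le> D" using n_ge[of k] by (simp add: defs)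
      have tD: "2 * theta + tB \<le> tD" using tn[of 2] n_ge[of k] by simp
      show ?thesis unfolding E using IH(1-3) IH4 bds tB D tD unfolding defs(6)[symmetric]
        by (intro conjI; argo)
    next
      case e: False
      then have "e (Suc k) = - 1" using e_cases[of "Suc k"] by auto
      then have E: "E = - 1" "tE = - theta" "W = Y k" using W by (simp_all add: defs)
      have n4: "4 \<le> n k" using e e_two n_even_ge False by blast
      then have D: "4 + B k \<le> D" by (simp add: defs)
      have tD: "4 * theta + tB \<le> tD" using tn[of 4] n4 by simp
      show ?thesis unfolding E using IH(1-3) IH4 bds tB D tD unfolding defs(6)[symmetric]
        by (intro conjI; argo)
    qed
  qed
  then have "- 1 * Y (Suc k) \<le> 1 / 2 + 0 * B (Suc k) \<and> 3 * Y (Suc k) \<le> 1 + 1 * B (Suc k)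
    \<and> 12 * Y (Suc k) \<le> (4 + theta) + 3 * B (Suc k)
    \<and> 12 * Y (Suc k) \<le> (3 + 3 * theta) + (4 + theta) * B (Suc k)"
    by (intro conjI linear_Suc) (simp_all add: defs distrib_right distrib_left)
  then show ?case by simp
qed

lemma Y_bounds:
  "- 1 / 2 \<le> Y k" "3 * Y k \<le> 1 + B k" "12 * Y k \<le> 4 + theta + 3 * B k"
  using Y_bounds_conj by blast+

text \<open>For digits 2 and 3 a vertex of the cell at \<open>Suc k\<close> may already be one of
  the cell at \<open>k\<close>. Its bound is then inherited, as forms and determinant rescale
  alike.\<close>

lemma vertex_Suc:
  assumes "T * (1 + al k * B k) \<le> P * Q" and "(n k + B k) * x = P" and "al k * y = Q"
  shows "T * (1 + al (Suc k) * B (Suc k)) \<le> x * y"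
proof -
  have p: "0 < al k * (n k + B k)" using den_gt_one[of k] al_pos[of k] by simp
  have "al k * (n k + B k) * (T * (1 + al (Suc k) * B (Suc k))) = T * (1 + al k * B k)"
    unfolding al_B_Suc[of k, symmetric] by simp
  also have "\<dots> \<le> al k * (n k + B k) * (x * y)"
    using assms(1) unfolding assms(2,3)[symmetric] by (simp add: mult_ac)
  finally show ?thesis using mult_le_cancel_left_pos[OF p] by blast
qed

lemma al_mult_signed: "al k * (e (Suc k) * al (Suc k)) = 1 - al k * n k"
  using al_mult_den[of k] by (simp add: algebra_simps)

lemma B_Suc_sign: "e (Suc k) = 1 \<Longrightarrow> 0 < B (Suc k)" "e (Suc k) = - 1 \<Longrightarrow> B (Suc k) < 0"
  using den_gt_one[of k] by (auto simp: B_Suc)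

text \<open>The line \<open>K * (3 - c + B) = 1 + B - Y\<close>, pulled back by digit 4 with sign
  -1, has slope \<open>1 - K * (3 - c)\<close>, and \<open>K_eq\<close> says that the pulled-back
  line passes through \<open>(theta, (1 + theta) / 3)\<close>. The limits \<open>1 / 4\<close> and
  \<open>1 / 3\<close> are the slopes of the two upper bounds in \<open>Y_bounds\<close>.\<close>

context
  fixes c K :: real
  assumes c: "0 < c" "c \<le> 1 / 2"
    and K: "0 < K" "K \<le> 3 / 10" "1 / 4 \<le> 1 - K * (3 - c)" "1 - K * (3 - c) \<le> 1 / 3"
    and K_eq: "K * ((3 - c) * (4 + theta) - 1) = 2 / 3 * (4 + theta)"
begin

lemma Y_le_line: "Y k \<le> (1 + theta) / 3 + (1 - K * (3 - c)) * (B k - theta)"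
proof -
  \<comment> \<open>The weight for which combining the lines of slopes \<open>1 / 3\<close> and
    \<open>1 / 4\<close> yields slope \<open>1 - K * (3 - c)\<close>.\<close>
  define t where "t = 12 * (1 - K * (3 - c)) - 3"
  have "0 \<le> t * (4 + 4 * B k - 12 * Y k)" using K Y_bounds[of k] by (auto simp: t_def)
  moreover have "0 \<le> (1 - t) * (4 + theta + 3 * B k - 12 * Y k)"
    using K Y_bounds[of k] by (intro mult_nonneg_nonneg) (auto simp: t_def)
  ultimately have "0 \<le> t * (4 + 4 * B k - 12 * Y k) + (1 - t) * (4 + theta + 3 * B k - 12 * Y k)"
    by simp
  also have "\<dots> = 12 * ((1 + theta) / 3 + (t + 3) / 12 * (B k - theta) - Y k)"
    by (simp add: field_simps)
  finally have "Y k \<le> (1 + theta) / 3 + (t + 3) / 12 * (B k - theta)"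
    unfolding zero_le_mult_iff by linarith
  moreover have "(t + 3) / 12 = 1 - K * (3 - c)" by (simp add: t_def)
  ultimately show ?thesis by simp
qed

lemma past_bound: "K * (3 - c + B (Suc k)) \<le> 1 + B (Suc k) - Y (Suc k)"
proof -
  define r where "r = 1 - K * (3 - c)"
  have r: "1 / 4 \<le> r" "r \<le> 1 / 3" using K by (auto simp: r_def)
  note bds = B_bounds[of k] abs_B_Y[of k] Y_bounds[of k]
  have rn: "x * r + r * B k \<le> r * (n k + B k)" if "x \<le> n k" for x :: real
    using r that mult_left_mono[of x "n k" r] by (simp add: algebra_simps)
  define rB where "rB = r * B k"
  have rB: "- r \<le> rB" "rB - B k / 3 \<ge> r - 1 / 3"
  proof -
    show "- r \<le> rB" unfolding rB_def using r bds mult_left_mono[of "- 1" "B k" r] by auto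
    have "(1 / 3 - r) * B k \<le> (1 / 3 - r) * 1" using r bds by (intro mult_left_mono) auto
    then show "rB - B k / 3 \<ge> r - 1 / 3" by (simp add: rB_def algebra_simps)
  qed
  have "1 * Y (Suc k) \<le> r + (1 - K) * B (Suc k)"
  proof (rule linear_Suc, cases "odd (n k)")
    case True
    then have "3 \<le> n k" by (rule n_odd_ge)
    then have "3 * r + rB \<le> r * (n k + B k)" using rn[of 3] by (simp add: rB_def)
    then show "1 * ((n k + B k) * Y (Suc k)) \<le> r * (n k + B k) + (1 - K) * e (Suc k)"
      using e_real[of "Suc k"] bds rB r K unfolding den_mult_Y_odd[OF True]
      by (elim disjE) simp_all
  next
    case even: False
    then have ev: "even (n k)" by simp
    show "1 * ((n k + B k) * Y (Suc k)) \<le> r * (n k + B k) + (1 - K) * e (Suc k)"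
    proof (cases "e (Suc k) = 1")
      case True
      have "2 * r + rB \<le> r * (n k + B k)" using rn[of 2] n_ge[of k] by (simp add: rB_def)
      then show ?thesis using True bds rB r K unfolding den_mult_Y_even[OF ev] by simp
    next
      case False
      then have e: "e (Suc k) = - 1" using e_cases[of "Suc k"] by auto
      then have "4 \<le> n k" using n_even_ge[OF ev] e_two[of k] by auto
      then have n4: "4 * r + rB \<le> r * (n k + B k)" using rn[of 4] by (simp add: rB_def)
      define R1 rt where "R1 = r * (n k + B k)" and "rt = r * theta"
      have "r * (4 + theta) + K = (4 + theta) - K * ((3 - c) * (4 + theta) - 1)"
        by (simp add: r_def algebra_simps)
      then have "4 * r + rt + K = (4 + theta) / 3" unfolding K_eq by (simp add: rt_def field_simps)
      moreover have "Y k \<le> (1 + theta) / 3 + rB - rt"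
        using Y_le_line[of k] by (simp add: r_def rB_def rt_def algebra_simps)
      ultimately have "Y k \<le> R1 - 1 + K" using n4 unfolding R1_def[symmetric] by argo
      then show ?thesis using e unfolding den_mult_Y_even[OF ev] by (simp add: R1_def)
    qed
  qed
  then show ?thesis by (simp add: r_def algebra_simps)
qed

lemma future_bound:
  assumes H: "al (Suc k) - z (Suc k) \<le> c" and b: "- 1 < b"
  shows "(1 - c) * (1 + al k * b) \<le> (1 - al k - z k) * (3 - c + b)"
proof -
  define p where "p = n k + e (Suc k) * al (Suc k)"
  have ap: "al k * p = 1" unfolding p_def by (rule al_mult_den)
  note bds = al_pos[of "Suc k"] al_less[of "Suc k"] z_nonneg[of "Suc k"] z_le[of "Suc k"]
  have one: "1 + al k * b = al k * (p + b)" by (simp add: distrib_left ap)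
  have "(1 - c) * (p + b) * al k \<le> al k * ((1 - al k - z k) / al k) * (3 - c + b)"
  proof (cases "odd (n k)")
    case True
    define z' where "z' = z (Suc k)"
    have two: "1 - al k - z k = al k * (p - 2 + z')"
      using z_odd[OF True] ap by (simp add: z'_def algebra_simps)
    have "0 \<le> p - 3 + z' + c"
      using n_odd_ge[OF True] H bds e_real[of "Suc k"] by (auto simp: p_def z'_def)
    \<comment> \<open>Both summands vanish for the extremal future \<open>p = 3 - c\<close>,
      \<open>z' = 0\<close>.\<close>
    then have "0 \<le> (p - 3 + z' + c) * (2 + b) + (1 - c) * z'" using b c bds by (simp add: z'_def)
    also have "\<dots> = (p - 2 + z') * (3 - c + b) - (1 - c) * (p + b)" by algebra
    finally have "(1 - c) * (p + b) \<le> (p - 2 + z') * (3 - c + b)" by simp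
    from mult_left_mono[OF this, of "al k"] show ?thesis
      using al_pos[of k] unfolding two by (simp add: mult_ac)
  next
    case False
    define z' where "z' = z (Suc k)"
    have two: "1 - al k - z k = al k * (p - 1 - z')"
      using z_even[of k] False ap by (simp add: z'_def algebra_simps)
    have "1 \<le> p - 1 - z'"
    proof (cases "n k = 2")
      case True
      then show ?thesis using e_two[OF True] bds by (simp add: p_def z'_def)
    next
      case n: False
      have "4 \<le> real_of_int (n k)" using n_even_ge[of k] n False by simp
      then show ?thesis using bds e_real[of "Suc k"] by (auto simp: p_def z'_def)
    qed
    then have ge: "1 * (2 + b) \<le> (p - 1 - z') * (2 + b)" using b by (intro mult_right_mono) auto
    have "(1 - c) * (1 + z' + b) \<le> 1 * (1 + z' + b)"
      using c b bds by (intro mult_right_mono) (auto simp: z'_def)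
    also have "\<dots> \<le> 1 * (2 + b)" using bds by (simp add: z'_def)
    also note ge
    finally have "0 \<le> (p - 1 - z') * (2 + b) - (1 - c) * (1 + z' + b)" by simp
    also have "\<dots> = (p - 1 - z') * (3 - c + b) - (1 - c) * (p + b)" by algebra
    finally have "(1 - c) * (p + b) \<le> (p - 1 - z') * (3 - c + b)" by simp
    from mult_left_mono[OF this, of "al k"] show ?thesis
      using al_pos[of k] unfolding two by (simp add: mult_ac)
  qed
  then show ?thesis using al_pos[of k] unfolding one by (simp add: mult_ac)
qed

lemma vertex_pm:
  assumes "al (Suc (Suc k)) - z (Suc (Suc k)) \<le> c"
  shows "K * (1 - c) * (1 + al (Suc k) * B (Suc k))
    \<le> (1 + B (Suc k) - Y (Suc k)) * (1 - al (Suc k) - z (Suc k))"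
proof -
  have "K * ((1 - c) * (1 + al (Suc k) * B (Suc k)))
      \<le> K * ((1 - al (Suc k) - z (Suc k)) * (3 - c + B (Suc k)))"
    using K(1) future_bound[OF assms B_bounds(1)] by (intro mult_left_mono) auto
  also have "\<dots> = (K * (3 - c + B (Suc k))) * (1 - al (Suc k) - z (Suc k))" by simp
  also have "\<dots> \<le> (1 + B (Suc k) - Y (Suc k)) * (1 - al (Suc k) - z (Suc k))"
    using past_bound[of k] al_less[of "Suc k"] z_le[of "Suc k"] by (intro mult_right_mono) auto
  finally show ?thesis by (simp add: mult_ac)
qed

context
  fixes J :: nat
  assumes H: "\<And>j. j \<ge> J \<Longrightarrow> al j - z j \<le> c"
begin

lemma vertex_pp:
  assumes k: "J + 1 \<le> k"
  shows "K * (1 - c) * (1 + al (Suc k) * B (Suc k))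
    \<le> (1 + B (Suc k) + Y (Suc k)) * (1 - al (Suc k) + z (Suc k))"
proof (cases "e (Suc k) = 1")
  case True
  have Bp: "0 < B (Suc k)" using B_Suc_sign True by simp
  have "1 + al (Suc k) * B (Suc k) \<le> 1 + B (Suc k)"
    using Bp al_less[of "Suc k"] by simp
  also have "K * \<dots> \<le> 3 / 10 * (1 + B (Suc k))" using K Bp by (intro mult_right_mono) auto
  finally have "K * (1 + al (Suc k) * B (Suc k)) \<le> 1 + B (Suc k) + Y (Suc k)"
    using K Y_bounds[of "Suc k"] Bp by simp
  then have "(K * (1 + al (Suc k) * B (Suc k))) * (1 - c)
    \<le> (1 + B (Suc k) + Y (Suc k)) * (1 - al (Suc k) + z (Suc k))"
    using H[of "Suc k"] k c abs_B_Y[of "Suc k"] by (intro mult_mono) auto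
  then show ?thesis by (simp add: mult_ac)
next
  case False
  then have e: "e (Suc k) = - 1" using e_cases[of "Suc k"] by auto
  have Bn: "B (Suc k) < 0" using B_Suc_sign e by simp
  show ?thesis
  proof (cases "n k = 3")
    case True
    \<comment> \<open>With digit 3 and sign -1 this vertex is the critical vertex of the preceding
      cell.\<close>
    then have o: "odd (n k)" by simp
    obtain k' where k': "k = Suc k'" using k by (cases k) auto
    show ?thesis
    proof (rule vertex_Suc)
      show "K * (1 - c) * (1 + al k * B k) \<le> (1 + B k - Y k) * (1 - al k - z k)"
        unfolding k' using k k' by (intro vertex_pm H) simp
      show "(n k + B k) * (1 + B (Suc k) + Y (Suc k)) = 1 + B k - Y k"
        using den_mult_B[of k] den_mult_Y_odd[OF o] e True by (simp add: distrib_left)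
      show "al k * (1 - al (Suc k) + z (Suc k)) = 1 - al k - z k"
        using al_mult_signed[of k] z_odd[OF o] e True by (simp add: algebra_simps)
    qed
  next
    case n3: False
    have n4: "4 \<le> n k" using e_two[of k] e n3 n_ge[of k] by (cases "n k = 2") auto
    define M where "M = (1 - K) * (n k + B k)"
    have M: "7 / 10 * (n k + B k) \<le> M"
      unfolding M_def using K den_gt_one[of k] by (intro mult_right_mono) auto
    have Kc: "0 \<le> K * c" using K c by simp
    \<comment> \<open>Past and future are again separated by an affine function of \<open>B\<close>,
      now \<open>1 + c * B (Suc k)\<close>.\<close>
    have "- 1 * Y (Suc k) \<le> (1 - K) + (1 - K * c) * B (Suc k)"
    proof (rule linear_Suc, cases "odd (n k)")
      case True
      have "5 \<le> n k" using n4 True by (cases "n k = 4") auto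
      then have "5 \<le> real_of_int (n k)" by simp
      then have "1 + Y k \<le> M - 1 + K * c"
        using M Kc Y_bounds[of k] B_bounds[of k] by argo
      then show "- 1 * ((n k + B k) * Y (Suc k)) \<le> (1 - K) * (n k + B k) + (1 - K * c) * e (Suc k)"
        using e unfolding den_mult_Y_odd[OF True] M_def by simp
    next
      case False
      then have ev: "even (n k)" by simp
      have "4 \<le> real_of_int (n k)" using n4 by simp
      then have "- Y k \<le> M - 1 + K * c"
        using M Kc Y_bounds[of k] B_bounds[of k] by argo
      then show "- 1 * ((n k + B k) * Y (Suc k)) \<le> (1 - K) * (n k + B k) + (1 - K * c) * e (Suc k)"
        using e unfolding den_mult_Y_even[OF ev] M_def by simp
    qed
    then have past: "K * (1 + c * B (Suc k)) \<le> 1 + B (Suc k) + Y (Suc k)"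
      by (simp add: algebra_simps)
    define d where "d = c - al (Suc k) + z (Suc k)"
    have d: "0 \<le> d" using H[of "Suc k"] k by (simp add: d_def)
    have "0 \<le> (1 - c) * (- B (Suc k))" using c Bn by (intro mult_nonneg_nonneg) auto
    from mult_nonneg_nonneg[OF this z_nonneg[of "Suc k"]]
    have "0 \<le> d * (1 + B (Suc k)) + (1 - c) * (- B (Suc k)) * z (Suc k)"
      using d B_bounds[of "Suc k"] by (intro add_nonneg_nonneg) auto
    also have "\<dots> = (1 - al (Suc k) + z (Suc k)) * (1 + c * B (Suc k)) - (1 - c) * (1 + al (Suc k) * B (Suc k))"
      unfolding d_def by algebra
    finally have "K * ((1 - c) * (1 + al (Suc k) * B (Suc k)))
        \<le> K * ((1 - al (Suc k) + z (Suc k)) * (1 + c * B (Suc k)))"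
      using K by (intro mult_left_mono) auto
    also have "\<dots> = (K * (1 + c * B (Suc k))) * (1 - al (Suc k) + z (Suc k))" by simp
    also have "\<dots> \<le> (1 + B (Suc k) + Y (Suc k)) * (1 - al (Suc k) + z (Suc k))"
      using past al_less[of "Suc k"] z_nonneg[of "Suc k"] by (intro mult_right_mono) auto
    finally show ?thesis by (simp add: mult_ac)
  qed
qed

lemma K_c_le: "K * (1 - c) \<le> 3 / 10" "0 < K * (1 - c)"
  using K c mult_mono[of K "3 / 10" "1 - c" 1] by auto

lemma al_B_le: "1 + al k * B k \<le> 3 / 2"
  using mult_mono[of "al k" "1 / 2" "B k" 1] al_pos[of k] al_less[of k] B_bounds[of k]
    mult_nonneg_nonpos[of "al k" "B k"] by (cases "0 \<le> B k") auto

lemma vertex_mp: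
  assumes k: "J + 1 \<le> k"
  shows "K * (1 - c) * (1 + al (Suc k) * B (Suc k))
    \<le> (1 - B (Suc k) + Y (Suc k)) * (1 + al (Suc k) - z (Suc k))"
proof (cases "n k = 2")
  case True
  then have ev: "even (n k)" by simp
  obtain k' where k': "k = Suc k'" using k by (cases k) auto
  show ?thesis
  proof (rule vertex_Suc)
    show "K * (1 - c) * (1 + al k * B k) \<le> (1 + B k - Y k) * (1 - al k - z k)"
      unfolding k' using k k' by (intro vertex_pm H) simp
    show "(n k + B k) * (1 - B (Suc k) + Y (Suc k)) = 1 + B k - Y k"
      using den_mult_B[of k] den_mult_Y_even[OF ev] e_two[OF True] True by (simp add: algebra_simps)
    show "al k * (1 + al (Suc k) - z (Suc k)) = 1 - al k - z k"
      using al_mult_signed[of k] z_even[OF ev] e_two[OF True] True by (simp add: algebra_simps)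
  qed
next
  case n2: False
  have "K * (1 - c) * (1 + al (Suc k) * B (Suc k)) \<le> 3 / 10 * (3 / 2)"
    using K_c_le al_B_le[of "Suc k"] al_B_pos[of "Suc k"] by (intro mult_mono) auto
  also have "\<dots> \<le> 1 / 2 * 1" by simp
  also have "\<dots> \<le> (1 - B (Suc k) + Y (Suc k)) * (1 + al (Suc k) - z (Suc k))"
  proof (intro mult_mono)
    have "- 1 * Y (Suc k) \<le> 1 / 2 + - 1 * B (Suc k)" if "e (Suc k) = 1"
    proof (rule linear_Suc, cases "odd (n k)")
      case True
      then show "- 1 * ((n k + B k) * Y (Suc k)) \<le> 1 / 2 * (n k + B k) + - 1 * real_of_int (e (Suc k))"
        using n_odd_ge[OF True] Y_bounds[of k] B_bounds[of k] that unfolding den_mult_Y_odd[OF True]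
        by simp
    next
      case False
      then have ev: "even (n k)" by simp
      show "- 1 * ((n k + B k) * Y (Suc k)) \<le> 1 / 2 * (n k + B k) + - 1 * real_of_int (e (Suc k))"
        using n_even_ge[OF ev n2] Y_bounds[of k] B_bounds[of k] that unfolding den_mult_Y_even[OF ev]
        by (simp add: field_simps)
    qed
    then show "1 / 2 \<le> 1 - B (Suc k) + Y (Suc k)"
      using e_cases[of "Suc k"] B_Suc_sign[of k] Y_bounds[of "Suc k"] by auto
  qed (use z_le[of "Suc k"] abs_B_Y[of "Suc k"] in auto)
  finally show ?thesis .
qed

text \<open>For sign 1, digit 2 identifies this vertex with that of \<open>vertex_pp\<close> one
  level earlier, and digit 3 with the critical one. The first case needs \<open>vertex_pp\<close> at
  the preceding index, hence \<open>J + 2\<close> instead of \<open>J + 1\<close>.\<close>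

lemma vertex_mm:
  assumes k: "J + 2 \<le> k"
  shows "K * (1 - c) * (1 + al (Suc k) * B (Suc k))
    \<le> (1 - B (Suc k) - Y (Suc k)) * (1 + al (Suc k) + z (Suc k))"
proof (cases "e (Suc k) = 1")
  case False
  then have e: "e (Suc k) = - 1" using e_cases[of "Suc k"] by auto
  have "K * (1 - c) * (1 + al (Suc k) * B (Suc k)) \<le> 3 / 10 * (3 / 2)"
    using K_c_le al_B_le[of "Suc k"] al_B_pos[of "Suc k"] by (intro mult_mono) auto
  also have "\<dots> \<le> 2 / 3 * 1" by simp
  also have "\<dots> \<le> (1 - B (Suc k) - Y (Suc k)) * (1 + al (Suc k) + z (Suc k))"
    using B_Suc_sign(2)[OF e] Y_bounds[of "Suc k"] al_pos[of "Suc k"] z_nonneg[of "Suc k"]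
    by (intro mult_mono) auto
  finally show ?thesis .
next
  case e: True
  obtain k' where k': "k = Suc k'" using k by (cases k) auto
  consider "n k = 2" | "n k = 3" | "4 \<le> n k" using n_ge[of k] by linarith
  then show ?thesis
  proof cases
    case 1
    then have ev: "even (n k)" by simp
    show ?thesis
    proof (rule vertex_Suc)
      show "K * (1 - c) * (1 + al k * B k) \<le> (1 + B k + Y k) * (1 - al k + z k)"
        unfolding k' using k k' by (intro vertex_pp) simp
      show "(n k + B k) * (1 - B (Suc k) - Y (Suc k)) = 1 + B k + Y k"
        using den_mult_B[of k] den_mult_Y_even[OF ev] e 1 by (simp add: algebra_simps)
      show "al k * (1 + al (Suc k) + z (Suc k)) = 1 - al k + z k"
        using al_mult_signed[of k] z_even[OF ev] e 1 by (simp add: algebra_simps)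
    qed
  next
    case 2
    then have o: "odd (n k)" by simp
    show ?thesis
    proof (rule vertex_Suc)
      show "K * (1 - c) * (1 + al k * B k) \<le> (1 + B k - Y k) * (1 - al k - z k)"
        unfolding k' using k k' by (intro vertex_pm H) simp
      show "(n k + B k) * (1 - B (Suc k) - Y (Suc k)) = 1 + B k - Y k"
        using den_mult_B[of k] den_mult_Y_odd[OF o] e 2 by (simp add: algebra_simps)
      show "al k * (1 + al (Suc k) + z (Suc k)) = 1 - al k - z k"
        using al_mult_signed[of k] z_odd[OF o] e 2 by (simp add: algebra_simps)
    qed
  next
    case 3
    have "1 * Y (Suc k) \<le> 7 / 10 + - 1 * B (Suc k)"
    proof (rule linear_Suc, cases "odd (n k)")
      case True
      have "5 \<le> n k" using 3 True by (cases "n k = 4") auto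
      then show "1 * ((n k + B k) * Y (Suc k)) \<le> 7 / 10 * (n k + B k) + - 1 * real_of_int (e (Suc k))"
        using e Y_bounds[of k] B_bounds[of k] unfolding den_mult_Y_odd[OF True] by simp
    next
      case False
      then have ev: "even (n k)" by simp
      show "1 * ((n k + B k) * Y (Suc k)) \<le> 7 / 10 * (n k + B k) + - 1 * real_of_int (e (Suc k))"
        using 3 e Y_bounds[of k] B_bounds[of k] unfolding den_mult_Y_even[OF ev]
        by (simp add: field_simps)
    qed
    then have "3 / 10 \<le> 1 - B (Suc k) - Y (Suc k)" by simp
    moreover have aB: "al (Suc k) * B (Suc k) \<le> al (Suc k) * 1"
      using al_pos[of "Suc k"] B_bounds[of "Suc k"] by (intro mult_left_mono) auto
    have "1 + al (Suc k) * B (Suc k) \<le> 1 + al (Suc k) + z (Suc k)"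
      using z_nonneg[of "Suc k"] aB by linarith
    ultimately show ?thesis
      using K_c_le al_pos[of "Suc k"] al_B_pos[of "Suc k"] by (intro mult_mono) linarith+
  qed
qed

lemma vertices_ge_small:
  assumes "J + 3 \<le> k"
  shows "vertices_ge (K * (1 - c)) k"
proof -
  obtain k' where k': "k = Suc k'" using assms by (cases k) auto
  show ?thesis
    using vertex_pp[of k'] vertex_pm[of k', OF H] vertex_mp[of k'] vertex_mm[of k'] assms
    unfolding vertices_ge_def k' by simp
qed

end

end

end

section \<open>Vertices for partial quotients at least four\<close>

lemma linear_nonneg_between:
  fixes p q x u :: real
  assumes "0 \<le> x" "x \<le> u" "0 \<le> p" "0 \<le> p + u * q"
  shows "0 \<le> p + x * q"
proof (cases "0 \<le> q")
  case True
  then show ?thesis using assms by simp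
next
  case False
  then have "u * q \<le> x * q" using assms by (intro mult_right_mono_neg) auto
  then show ?thesis using assms by linarith
qed

context cell_chain
begin

text \<open>Here \<open>g\<close> bounds the past factor and \<open>h\<close> the future factor from
  below; multiplied by \<open>D\<close>, the determinant becomes
  \<open>D + e (Suc k) * al (Suc k)\<close>.\<close>

lemma vertex_Suc_mult:
  assumes "D = n k + B k" and "D * x = X" and "D * g \<le> X" and "h \<le> y" and "0 \<le> g" and "0 \<le> h"
    and "T * (D + e (Suc k) * al (Suc k)) \<le> D * (g * h)"
  shows "T * (1 + al (Suc k) * B (Suc k)) \<le> x * y"
proof -
  have D: "0 < D" using assms(1) den_gt_one[of k] by linarith
  have x: "g \<le> x" using assms(3) D unfolding assms(2)[symmetric] by simp
  have "D * (T * (1 + al (Suc k) * B (Suc k))) = T * (D + al (Suc k) * (D * B (Suc k)))"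
    by (simp add: algebra_simps)
  also have "\<dots> = T * (D + e (Suc k) * al (Suc k))"
    unfolding assms(1) den_mult_B by simp
  also note assms(7)
  finally have "T * (1 + al (Suc k) * B (Suc k)) \<le> g * h" using D by simp
  also have "\<dots> \<le> x * y" using x assms by (intro mult_mono) auto
  finally show ?thesis .
qed

text \<open>\<open>Od\<close> and \<open>Ev\<close> bound odd and even digits; in the application
  one of them is \<open>R\<close> and the other \<open>R + 1\<close>. \<open>b\<close> is a first
  bound for \<open>\<bar>B\<bar>\<close> and \<open>al\<close>, and \<open>b2\<close> its refinement
  by one more step; \<open>Q\<close> and \<open>S\<close> bound the denominators at odd and even
  digits, \<open>Yb\<close> bounds \<open>\<bar>Y\<bar>\<close>. To first order in
  \<open>1 / R\<close>, the conditions \<open>E2\<close>, \<open>E6\<close>, \<open>E8\<close>,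
  \<open>C1\<close> allow \<open>T\<close> up to \<open>1 - 2 / R\<close>, the conditions
  \<open>G1\<close> to \<open>G2_neg\<close> only up to \<open>1 - 3 / R\<close>.\<close>

context
  fixes R Ev Od T b b2 Q S Yb :: real and k0 :: nat
  assumes n_R: "\<And>k. k \<ge> k0 \<Longrightarrow> R \<le> n k"
    and n_Od: "\<And>k. k \<ge> k0 \<Longrightarrow> odd (n k) \<Longrightarrow> Od \<le> n k"
    and n_Ev: "\<And>k. k \<ge> k0 \<Longrightarrow> even (n k) \<Longrightarrow> Ev \<le> n k"
    and R4: "4 \<le> R" and Od5: "5 \<le> Od" and Ev4: "4 \<le> Ev"
    and b_def: "b = 1 / (R - 1)" and b2_def: "b2 = 1 / (R - b)" and Q_def: "Q = Od - b"
    and S_def: "S = Ev - b" and Yb_def: "Yb = 1 / (Q - 2)"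
    and T: "0 \<le> T"
    and E2: "T * (1 + b2 * b2) \<le> (1 - Yb * b2) * (1 - 2 / Q)"
    and E6: "T \<le> (1 - (2 + Yb) / Q) * (1 - b * b2)"
    and E8: "T \<le> (1 - (1 + Yb) * b2) * (1 - b2 * (1 + b))"
    and C1: "T \<le> (1 - Yb) * (1 - 1 / S)"
    and G1: "T * (Od + 1 / Q - 1 / S) \<le> (Od - 2 - Yb / Q) * (1 - 1 / S)"
    and G1_neg: "T * (Od - b2 - 1 / S) \<le> (Od - 2 - b2 * (1 + Yb)) * (1 - 1 / S)"
    and G2: "T * Ev \<le> (Ev - 1 - Yb / Q) * (1 - 2 / Q)"
    and G2_pos: "T * (Ev + b2 - 1 / Q) \<le> (Ev - 1 + b2 * (1 - Yb)) * (1 - 2 / Q)"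
    and G2_neg: "T * (Ev - b2 - 1 / Q) \<le> (Ev - 1 - b2 * (1 + Yb)) * (1 - 2 / Q)"
    and b2_Q: "b2 * (1 + b) \<le> 2 / Q"
begin

lemma basic_bounds:
  "0 < b" "b \<le> 1 / 3" "0 < b2" "b2 \<le> 3 / 11" "14 / 3 \<le> Q" "11 / 3 \<le> S" "0 < Yb" "Yb \<le> 3 / 8"
  "11 / 3 \<le> R - b" "b2 \<le> b"
proof -
  show b: "0 < b" "b \<le> 1 / 3" using R4 by (auto simp: b_def field_simps)
  show Rb: "11 / 3 \<le> R - b" using b R4 by simp
  then show b2: "0 < b2" "b2 \<le> 3 / 11" by (auto simp: b2_def field_simps)
  show Q: "14 / 3 \<le> Q" using b Od5 by (simp add: Q_def)
  show "11 / 3 \<le> S" using b Ev4 by (simp add: S_def)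
  show "0 < Yb" "Yb \<le> 3 / 8" using Q by (auto simp: Yb_def field_simps)
  have "1 / (R - b) \<le> 1 / (R - 1)" using Rb R4 b by (intro divide_left_mono mult_pos_pos) auto
  then show "b2 \<le> b" by (simp add: b2_def b_def)
qed

lemma abs_B_le_b:
  assumes "k0 + 1 \<le> k"
  shows "\<bar>B k\<bar> \<le> b"
proof -
  obtain j where j: "k = Suc j" using assms by (cases k) auto
  have "R - 1 \<le> n j + B j" using n_R[of j] assms j B_bounds[of j] by simp
  then have "1 / (n j + B j) \<le> b" unfolding b_def using R4 by (intro divide_left_mono) auto
  moreover have "\<bar>B k\<bar> = 1 / (n j + B j)"
    unfolding j B_Suc using e_real[of "Suc j"] den_gt_one[of j] by auto
  ultimately show ?thesis by simp
qed

lemma den_ge: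
  assumes "k0 + 1 \<le> k"
  shows "R - b \<le> n k + B k" "odd (n k) \<Longrightarrow> Q \<le> n k + B k" "even (n k) \<Longrightarrow> S \<le> n k + B k"
  using abs_B_le_b[OF assms] n_R[of k] n_Od[of k] n_Ev[of k] assms by (auto simp: Q_def S_def)

lemma B_past:
  assumes "k0 + 1 \<le> k"
  shows "e (Suc k) * B (Suc k) \<le> b2" "odd (n k) \<Longrightarrow> e (Suc k) * B (Suc k) \<le> 1 / Q"
    "0 < e (Suc k) * B (Suc k)"
    "odd (n k) \<Longrightarrow> Y (Suc k) = B (Suc k) * (1 + Y k)" "even (n k) \<Longrightarrow> Y (Suc k) = - B (Suc k) * Y k"
proof -
  have eB: "e (Suc k) * B (Suc k) = 1 / (n k + B k)"
    using e_mult_den[of k] den_gt_one[of k] by (simp add: field_simps)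
  show "e (Suc k) * B (Suc k) \<le> b2" "odd (n k) \<Longrightarrow> e (Suc k) * B (Suc k) \<le> 1 / Q"
    "0 < e (Suc k) * B (Suc k)"
    unfolding eB b2_def using den_ge[OF assms] basic_bounds den_gt_one[of k]
    by (auto intro!: divide_left_mono mult_pos_pos)
  show "odd (n k) \<Longrightarrow> Y (Suc k) = B (Suc k) * (1 + Y k)" "even (n k) \<Longrightarrow> Y (Suc k) = - B (Suc k) * Y k"
    by (auto simp: B_Suc Y_odd Y_even)
qed

lemma abs_Y_Suc_le:
  assumes "k0 + 1 \<le> k"
  shows "odd (n k) \<Longrightarrow> \<bar>Y (Suc k)\<bar> \<le> (1 + \<bar>Y k\<bar>) / Q" "even (n k) \<Longrightarrow> \<bar>Y (Suc k)\<bar> \<le> b2 * \<bar>Y k\<bar>"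
proof -
  have aB: "\<bar>B (Suc k)\<bar> = e (Suc k) * B (Suc k)"
    using e_real[of "Suc k"] B_past(3)[OF assms] by auto
  show "\<bar>Y (Suc k)\<bar> \<le> (1 + \<bar>Y k\<bar>) / Q" if "odd (n k)"
  proof -
    have "\<bar>Y (Suc k)\<bar> = \<bar>B (Suc k)\<bar> * \<bar>1 + Y k\<bar>" by (simp add: B_past(4)[OF assms that] abs_mult)
    also have "\<dots> \<le> 1 / Q * (1 + \<bar>Y k\<bar>)"
      unfolding aB using B_past(2)[OF assms that] basic_bounds by (intro mult_mono) auto
    finally show ?thesis by simp
  qed
  show "\<bar>Y (Suc k)\<bar> \<le> b2 * \<bar>Y k\<bar>" if "even (n k)"
  proof -
    have "\<bar>Y (Suc k)\<bar> = \<bar>B (Suc k)\<bar> * \<bar>Y k\<bar>" by (simp add: B_past(5)[OF assms that] abs_mult)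
    also have "\<dots> \<le> b2 * \<bar>Y k\<bar>" unfolding aB using B_past(1)[OF assms] by (intro mult_right_mono) auto
    finally show ?thesis .
  qed
qed

text \<open>Two steps of the contraction \<open>y \<mapsto> (1 + y) / Q\<close> bring \<open>\<bar>Y\<bar>\<close> from below \<open>1\<close> to below
  \<open>1 / (Q - 2)\<close>, which slightly exceeds its fixed point \<open>1 / (Q - 1)\<close>.\<close>

lemma abs_Y_le:
  assumes "k0 + 3 \<le> k"
  shows "\<bar>Y k\<bar> \<le> Yb"
proof -
  have "k = Suc (Suc (k - 2))" "k0 + 1 \<le> k - 2" using assms by auto
  then obtain j where j: "k = Suc (Suc j)" "k0 + 1 \<le> j" by blast
  have "b2 * 1 \<le> b2 * (1 + b)" using basic_bounds by (intro mult_left_mono) auto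
  then have b2Q: "b2 \<le> 2 / Q" using b2_Q by linarith
  have Y1: "\<bar>Y j\<bar> \<le> 1" using abs_B_Y[of j] by linarith
  have Y2: "\<bar>Y (Suc j)\<bar> \<le> 2 / Q"
  proof (cases "odd (n j)")
    case True
    have "(1 + \<bar>Y j\<bar>) / Q \<le> 2 / Q" using Y1 basic_bounds by (intro divide_right_mono) auto
    then show ?thesis using abs_Y_Suc_le(1)[OF j(2) True] by linarith
  next
    case False
    have "b2 * \<bar>Y j\<bar> \<le> b2 * 1" using Y1 basic_bounds by (intro mult_left_mono) auto
    then show ?thesis using abs_Y_Suc_le(2)[OF j(2)] False b2Q by simp
  qed
  have j': "k0 + 1 \<le> Suc j" using j by simp
  show ?thesis
  proof (cases "odd (n (Suc j))")
    case True
    have "(1 + \<bar>Y (Suc j)\<bar>) / Q \<le> (1 + 2 / Q) / Q" using Y2 basic_bounds by (intro divide_right_mono) auto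
    also have "\<dots> \<le> Yb" unfolding Yb_def using basic_bounds by (simp add: field_simps)
    finally show ?thesis unfolding j using abs_Y_Suc_le(1)[OF j' True] by linarith
  next
    case False
    have "b2 * \<bar>Y (Suc j)\<bar> \<le> 1 / 2 * (2 / Q)" using Y2 basic_bounds by (intro mult_mono) auto
    also have "\<dots> \<le> Yb" unfolding Yb_def using basic_bounds by (simp add: field_simps)
    finally show ?thesis unfolding j using abs_Y_Suc_le(2)[OF j'] False by simp
  qed
qed

text \<open>\<open>Y k\<close> is \<open>B k * (1 + Y j)\<close> or \<open>- B k * Y j\<close> with
  \<open>j\<close> the preceding level, so it is bounded by a multiple of
  \<open>\<bar>B k\<bar>\<close>. Inequalities in \<open>B k\<close> and \<open>Y k\<close> thereby
  become affine in one variable and need checking only at the ends of its range.\<close>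

lemma B_Y_cases:
  assumes "k0 + 4 \<le> k"
  obtains (odd_pos) "0 \<le> B k" "B k \<le> 1 / Q" "Y k \<le> B k * (1 + Yb)"
    | (even_pos) "0 \<le> B k" "B k \<le> b2" "Y k \<le> B k * Yb"
    | (neg) x where "B k = - x" "0 \<le> x" "x \<le> b2" "Y k \<le> x * Yb"
proof -
  obtain j where j: "k = Suc j" using assms by (cases k) auto
  have j1: "k0 + 1 \<le> j" and Yj: "\<bar>Y j\<bar> \<le> Yb" using abs_Y_le[of j] assms j by auto
  note p = B_past[OF j1, folded j]
  show thesis
  proof (cases "e k = 1")
    case True
    then have B: "0 \<le> B k" "B k \<le> b2" using p j by auto
    show thesis
    proof (cases "odd (n j)")
      case odd: True
      have "B k * (1 + Y j) \<le> B k * (1 + Yb)" using Yj B by (intro mult_left_mono) auto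
      then show thesis using odd_pos p(2,4)[OF odd] B True j by simp
    next
      case False
      have "B k * (- Y j) \<le> B k * Yb" using Yj B by (intro mult_left_mono) auto
      then show thesis using even_pos p(5) False B by simp
    qed
  next
    case False
    then have e: "e k = - 1" using e_cases[of k] by auto
    define x where "x = - B k"
    have x: "B k = - x" "0 \<le> x" "x \<le> b2" using p e j by (auto simp: x_def)
    show thesis
    proof (cases "odd (n j)")
      case odd: True
      have "0 \<le> x * (1 + Y j)" "0 \<le> x * Yb" using x abs_B_Y[of j] basic_bounds
        by (auto intro!: mult_nonneg_nonneg)
      then show thesis using neg[OF x] p(4)[OF odd] x by simp
    next
      case False
      have "x * Y j \<le> x * Yb" using Yj x by (intro mult_left_mono) auto
      then show thesis using neg[OF x] p(5) False x by simp
    qed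
  qed
qed

text \<open>With \<open>z'\<close> the value of \<open>z\<close> at the next level,
  \<open>al - z\<close> is \<open>al * z'\<close> at an odd digit, thus of second order, and
  \<open>al + z\<close> is \<open>al * (1 + z')\<close> at an even digit.\<close>

lemma al_le:
  assumes "k0 \<le> k"
  shows "al k \<le> b2" "odd (n k) \<Longrightarrow> al k \<le> 1 / Q" "even (n k) \<Longrightarrow> al k \<le> 1 / S"
    "odd (n k) \<Longrightarrow> 1 - b * b2 \<le> 1 - al k + z k" "even (n k) \<Longrightarrow> 1 - b2 * (1 + b) \<le> 1 - al k - z k"
    "1 - 2 / Q \<le> 1 - al k - z k"
proof -
  have al_eq: "al j = 1 / (n j + e (Suc j) * al (Suc j))" for j
    by (simp add: al_rec[symmetric])
  have al_b: "al j \<le> b" if "k0 \<le> j" for j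
  proof -
    have "R - 1 \<le> n j + e (Suc j) * al (Suc j)"
      using n_R[OF that] e_real[of "Suc j"] al_pos[of "Suc j"] al_less[of "Suc j"] by auto
    then show ?thesis unfolding al_eq[of j] b_def using R4 by (intro divide_left_mono) auto
  qed
  have ge: "n k - b \<le> n k + e (Suc k) * al (Suc k)"
    using al_b[of "Suc k"] assms e_real[of "Suc k"] al_pos[of "Suc k"] basic_bounds(1) by auto
  show a: "al k \<le> b2" "odd (n k) \<Longrightarrow> al k \<le> 1 / Q" "even (n k) \<Longrightarrow> al k \<le> 1 / S"
    unfolding al_eq[of k] b2_def using ge basic_bounds n_R[OF assms] n_Od[OF assms] n_Ev[OF assms]
    by (auto intro!: divide_left_mono mult_pos_pos simp: Q_def S_def)
  have z': "z (Suc k) \<le> b" using al_b[of "Suc k"] assms z_le[of "Suc k"] by simp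
  show "1 - b * b2 \<le> 1 - al k + z k" if "odd (n k)"
  proof -
    have "al k * z (Suc k) \<le> b2 * b"
      using a z' al_pos[of k] z_nonneg[of "Suc k"] basic_bounds by (intro mult_mono) auto
    then show ?thesis unfolding z_odd[OF that] by (simp add: algebra_simps)
  qed
  have "al k * (1 + z (Suc k)) \<le> b2 * (1 + b)"
    using a z' al_pos[of k] z_nonneg[of "Suc k"] basic_bounds by (intro mult_mono) auto
  then show e: "1 - b2 * (1 + b) \<le> 1 - al k - z k" if "even (n k)"
    unfolding z_even[OF that] by (simp add: algebra_simps)
  show "1 - 2 / Q \<le> 1 - al k - z k"
  proof (cases "odd (n k)")
    case True
    then show ?thesis using a(2) z_le[of k] by simp
  next
    case False
    then show ?thesis using e b2_Q by simp
  qed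
qed

lemma factor_bounds:
  "0 \<le> 1 - Yb * b2" "0 \<le> 1 - (1 + Yb) * b2" "0 \<le> 1 - 2 / Q" "0 \<le> 1 - (2 + Yb) / Q"
  "0 \<le> 1 - b * b2" "0 \<le> 1 - b2 * (1 + b)" "0 \<le> 1 - 1 / S"
proof -
  note bb = basic_bounds
  have "Yb * b2 \<le> 1 * 1" "(1 + Yb) * b2 \<le> 2 * (1 / 2)" "b * b2 \<le> 1 * 1" "b2 * (1 + b) \<le> 1 / 2 * 2"
    using bb by (intro mult_mono; simp)+
  then show "0 \<le> 1 - Yb * b2" "0 \<le> 1 - (1 + Yb) * b2" "0 \<le> 1 - b * b2" "0 \<le> 1 - b2 * (1 + b)"
    by simp_all
  show "0 \<le> 1 - 2 / Q" "0 \<le> 1 - (2 + Yb) / Q" "0 \<le> 1 - 1 / S"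
    using bb by (simp_all add: field_simps)
qed

lemma T_bounds:
  "T \<le> (1 - Yb * b2) * (1 - 2 / Q)" "T \<le> 1 - 2 / Q" "T \<le> 1 - Yb * b2" "T \<le> 1 - (1 + Yb) * b2"
  "T \<le> 1 - (2 + Yb) / Q" "T \<le> 1 - 1 / S" "T \<le> 1"
proof -
  note bb = basic_bounds and fb = factor_bounds
  have "T * 1 \<le> T * (1 + b2 * b2)" using T bb by (intro mult_left_mono) auto
  then show t: "T \<le> (1 - Yb * b2) * (1 - 2 / Q)" using E2 by linarith
  have "(1 - Yb * b2) * (1 - 2 / Q) \<le> 1 * (1 - 2 / Q)" "(1 - Yb * b2) * (1 - 2 / Q) \<le> (1 - Yb * b2) * 1"
    using fb bb by (intro mult_mono; simp)+
  then show t2: "T \<le> 1 - 2 / Q" "T \<le> 1 - Yb * b2" using order_trans[OF t] by simp_all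
  have "(1 - (1 + Yb) * b2) * (1 - b2 * (1 + b)) \<le> (1 - (1 + Yb) * b2) * 1"
    using fb bb by (intro mult_mono) auto
  then show "T \<le> 1 - (1 + Yb) * b2" using order_trans[OF E8] by simp
  have "(1 - (2 + Yb) / Q) * (1 - b * b2) \<le> (1 - (2 + Yb) / Q) * 1"
    using fb bb by (intro mult_left_mono) auto
  then show "T \<le> 1 - (2 + Yb) / Q" using order_trans[OF E6] by simp
  have "(1 - Yb) * (1 - 1 / S) \<le> 1 * (1 - 1 / S)" using fb bb by (intro mult_right_mono) auto
  then show "T \<le> 1 - 1 / S" using order_trans[OF C1] by simp
  have "0 \<le> 2 / Q" using bb by simp
  then show "T \<le> 1" using t2 by linarith
qed

text \<open>The right side minus the left side is affine in \<open>n k\<close> and in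
  \<open>a\<close>. It decreases in \<open>a\<close>, and at \<open>a = 1 / S\<close> it increases
  in \<open>n k\<close>; this leaves \<open>n k = Od\<close>, \<open>a = 1 / S\<close>, where only
  the dependence on \<open>B k\<close> and \<open>Y k\<close> remains.\<close>

lemma tight_pp:
  assumes k: "k0 + 4 \<le> k" and odd: "odd (n k)" and a: "0 < a" "a \<le> 1 / S"
  shows "T * (n k + B k - a) \<le> (n k + B k - 2 - Y k) * (1 - a)"
proof -
  note bb = basic_bounds and fb = factor_bounds
  define q1 where "q1 = 1 - 1 / S"
  have q1: "T \<le> q1" "0 \<le> q1" using T_bounds fb by (auto simp: q1_def)
  have base: "T * (Od + B k - 1 / S) \<le> (Od - 2 + B k - Y k) * q1"
  proof -
    have zero: "0 \<le> (Od - 2) * q1 - T * (Od - 1 / S)"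
    proof -
      have "T * (Od - 1 / S) \<le> T * (Od + 1 / Q - 1 / S)" using T bb by (intro mult_left_mono) auto
      moreover have "(Od - 2 - Yb / Q) * q1 \<le> (Od - 2) * q1" using q1 bb by (intro mult_right_mono) auto
      ultimately show ?thesis using G1 unfolding q1_def by linarith
    qed
    from k show ?thesis
    proof (cases rule: B_Y_cases)
      case odd_pos
      have "0 \<le> (Od - 2) * q1 - T * (Od - 1 / S) + 1 / Q * (- Yb * q1 - T)"
        using G1 unfolding q1_def by (simp add: algebra_simps add_divide_distrib)
      from linear_nonneg_between[OF odd_pos(1,2) zero this]
      have "T * (Od + B k - 1 / S) \<le> (Od - 2 + B k - B k * (1 + Yb)) * q1" by (simp add: algebra_simps)
      also have "\<dots> \<le> (Od - 2 + B k - Y k) * q1" using odd_pos q1 by (intro mult_right_mono) auto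
      finally show ?thesis .
    next
      case even_pos
      have "0 \<le> B k * ((1 - Yb) * q1 - T)" using even_pos C1 by (simp add: q1_def)
      then have "T * (Od + B k - 1 / S) \<le> (Od - 2 + B k - B k * Yb) * q1"
        using zero by (simp add: algebra_simps)
      also have "\<dots> \<le> (Od - 2 + B k - Y k) * q1" using even_pos q1 by (intro mult_right_mono) auto
      finally show ?thesis .
    next
      case (neg x)
      have "0 \<le> (Od - 2) * q1 - T * (Od - 1 / S) + b2 * (T - (1 + Yb) * q1)"
        using G1_neg unfolding q1_def by (simp add: algebra_simps add_divide_distrib)
      from linear_nonneg_between[OF neg(2,3) zero this]
      have "T * (Od + B k - 1 / S) \<le> (Od - 2 + B k - x * Yb) * q1"
        unfolding neg(1) by (simp add: algebra_simps)
      also have "\<dots> \<le> (Od - 2 + B k - Y k) * q1" using neg q1 by (intro mult_right_mono) auto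
      finally show ?thesis .
    qed
  qed
  have n: "Od \<le> n k" using n_Od[OF _ odd] k by simp
  have "0 \<le> (n k - Od) * (q1 - T)" using n q1 by simp
  moreover have "0 \<le> (1 / S - a) * (n k + B k - 2 - Y k - T)"
    using a n k abs_B_le_b[of k] abs_Y_le[of k] bb T_bounds(7) Od5 by (intro mult_nonneg_nonneg) auto
  ultimately show ?thesis using base unfolding q1_def by (simp add: algebra_simps)
qed

text \<open>The counterpart of \<open>tight_pp\<close> with the parities exchanged;
  \<open>1 - 2 * a\<close> stands for \<open>1 - al - z\<close>, since
  \<open>z \<le> al\<close>.\<close>

lemma tight_pm:
  assumes k: "k0 + 4 \<le> k" and even: "even (n k)" and a: "0 < a" "a \<le> 1 / Q"
  shows "T * (n k + B k - a) \<le> (n k + B k - 1 - Y k) * (1 - 2 * a)"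
proof -
  note bb = basic_bounds and fb = factor_bounds
  define q where "q = 1 / Q"
  define q2 where "q2 = 1 - 2 * q"
  have q2: "T \<le> q2" "0 \<le> q2" and q: "0 < q" using T_bounds fb bb by (auto simp: q2_def q_def)
  have g: "T * Ev \<le> (Ev - 1 - Yb * q) * q2" "T * (Ev + b2 - q) \<le> (Ev - 1 + b2 * (1 - Yb)) * q2"
    "T * (Ev - b2 - q) \<le> (Ev - 1 - b2 * (1 + Yb)) * q2"
    using G2 G2_pos G2_neg by (auto simp: q2_def q_def)
  have base: "T * (Ev + B k - q) \<le> (Ev - 1 + B k - Y k) * q2"
  proof -
    have zero: "0 \<le> (Ev - 1) * q2 - T * (Ev - q)"
    proof -
      have "T * (Ev - q) \<le> T * Ev" using T q by (intro mult_left_mono) auto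
      moreover have "(Ev - 1 - Yb * q) * q2 \<le> (Ev - 1) * q2" using q2 q bb by (intro mult_right_mono) auto
      ultimately show ?thesis using g(1) by linarith
    qed
    from k show ?thesis
    proof (cases rule: B_Y_cases)
      case odd_pos
      have "0 \<le> (Ev - 1) * q2 - T * (Ev - q) + q * (- Yb * q2 - T)"
        using g(1) by (simp add: algebra_simps)
      from linear_nonneg_between[OF odd_pos(1) odd_pos(2)[folded q_def] zero this]
      have "T * (Ev + B k - q) \<le> (Ev - 1 + B k - B k * (1 + Yb)) * q2" by (simp add: algebra_simps)
      also have "\<dots> \<le> (Ev - 1 + B k - Y k) * q2" using odd_pos q2 by (intro mult_right_mono) auto
      finally show ?thesis .
    next
      case even_pos
      have "0 \<le> (Ev - 1) * q2 - T * (Ev - q) + b2 * ((1 - Yb) * q2 - T)"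
        using g(2) by (simp add: algebra_simps)
      from linear_nonneg_between[OF even_pos(1,2) zero this]
      have "T * (Ev + B k - q) \<le> (Ev - 1 + B k - B k * Yb) * q2" by (simp add: algebra_simps)
      also have "\<dots> \<le> (Ev - 1 + B k - Y k) * q2" using even_pos q2 by (intro mult_right_mono) auto
      finally show ?thesis .
    next
      case (neg x)
      have "0 \<le> (Ev - 1) * q2 - T * (Ev - q) + b2 * (T - (1 + Yb) * q2)"
        using g(3) by (simp add: algebra_simps)
      from linear_nonneg_between[OF neg(2,3) zero this]
      have "T * (Ev + B k - q) \<le> (Ev - 1 + B k - x * Yb) * q2"
        unfolding neg(1) by (simp add: algebra_simps)
      also have "\<dots> \<le> (Ev - 1 + B k - Y k) * q2" using neg q2 by (intro mult_right_mono) auto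
      finally show ?thesis .
    qed
  qed
  have n: "Ev \<le> n k" using n_Ev[OF _ even] k by simp
  have "0 \<le> (n k - Ev) * (q2 - T)" using n q2 by simp
  moreover have "0 \<le> (q - a) * (2 * (n k + B k - 1 - Y k) - T)"
    using a n k abs_B_le_b[of k] abs_Y_le[of k] bb T_bounds(7) Ev4
    by (intro mult_nonneg_nonneg) (auto simp: q_def)
  ultimately show ?thesis using base unfolding q2_def by (simp add: algebra_simps)
qed

lemma vertices_ge_large:
  assumes k: "k0 + 4 \<le> k"
  shows "vertices_ge T (Suc k)"
proof -
  note bb = basic_bounds
  define D where "D = n k + B k"
  define a where "a = al (Suc k)"
  define zz where "zz = z (Suc k)"
  define y where "y = Y k"
  have Db: "R - b \<le> D" "odd (n k) \<Longrightarrow> Q \<le> D" using den_ge[of k] k by (auto simp: D_def)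
  have D0: "0 < D" using den_gt_one[of k] by (simp add: D_def)
  have Db2: "1 \<le> D * b2" using Db(1) bb by (simp add: b2_def field_simps)
  have DQ: "1 \<le> D / Q" if "odd (n k)" using Db(2)[OF that] bb by simp
  have y: "- Yb \<le> y" "y \<le> Yb" using abs_Y_le[of k] k by (auto simp: y_def)
  have kS: "k0 \<le> Suc k" using k by simp
  note al = al_le[OF kS, folded a_def zz_def]
  have a: "0 < a" "0 \<le> zz" "zz \<le> a" "a < 1 / 2"
    using al_pos[of "Suc k"] al_less[of "Suc k"] z_nonneg[of "Suc k"] z_le[of "Suc k"]
    by (auto simp: a_def zz_def)
  have DB: "D * B (Suc k) = e (Suc k)" by (simp add: D_def den_mult_B)
  have DYo: "D * Y (Suc k) = e (Suc k) * (1 + y)" if "odd (n k)"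
    using den_mult_Y_odd[OF that] by (simp add: D_def y_def)
  have DYe: "D * Y (Suc k) = - e (Suc k) * y" if "even (n k)"
    using den_mult_Y_even[OF that] by (simp add: D_def y_def)
  have DYb: "D * (1 - Yb * b2) \<le> D - Yb" using mult_left_mono[OF Db2, of Yb] bb by (simp add: algebra_simps)
  have D8: "D * (1 - (1 + Yb) * b2) \<le> D - 1 - Yb"
    using mult_left_mono[OF Db2, of "1 + Yb"] bb by (simp add: algebra_simps)
  have D6: "D * (1 - (2 + Yb) / Q) \<le> D - 2 - Yb" if "odd (n k)"
    using mult_left_mono[OF DQ[OF that], of "2 + Yb"] bb by (simp add: algebra_simps add_divide_distrib)
  \<comment> \<open>For sign 1 this bounds the determinant by the factor \<open>1 + b2 * b2\<close>
    of \<open>E2\<close>.\<close>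
  have "1 * b2 \<le> (D * b2) * b2" using Db2 bb by (intro mult_right_mono) auto
  then have aD: "a \<le> D * (b2 * b2)" using al(1) unfolding mult.assoc by linarith
  define gY g8 g6 where g_defs: "gY = 1 - Yb * b2" "g8 = 1 - (1 + Yb) * b2" "g6 = 1 - (2 + Yb) / Q"
  note fb = factor_bounds[folded g_defs] and tb = T_bounds[folded g_defs]
    and E2 = E2[folded g_defs] and E6 = E6[folded g_defs] and E8 = E8[folded g_defs]
    and DYb = DYb[folded g_defs] and D8 = D8[folded g_defs] and D6 = D6[folded g_defs]
  from aD have Dsq: "D + a \<le> D * (1 + b2 * b2)" by (simp add: distrib_left)
  have TD: "T * (D - a) \<le> D * T" using T a mult_left_mono[of "D - a" D T] by (simp add: mult.commute)
  have TDg: "D * T \<le> D * g" if "T \<le> g" for g using that D0 by simp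
  have main: "T * (1 + al (Suc k) * B (Suc k)) \<le> (1 + B (Suc k) + Y (Suc k)) * (1 - a + zz)
    \<and> T * (1 + al (Suc k) * B (Suc k)) \<le> (1 + B (Suc k) - Y (Suc k)) * (1 - a - zz)
    \<and> T * (1 + al (Suc k) * B (Suc k)) \<le> (1 - B (Suc k) + Y (Suc k)) * (1 + a - zz)
    \<and> T * (1 + al (Suc k) * B (Suc k)) \<le> (1 - B (Suc k) - Y (Suc k)) * (1 + a + zz)"
  proof (cases "e (Suc k) = 1")
    case e: True
    have DB': "D * B (Suc k) = 1" using DB e by simp
    have K2: "T * (D + e (Suc k) * al (Suc k)) \<le> D * (gY * (1 - 2 / Q))"
    proof -
      have "T * (D + a) \<le> T * (D * (1 + b2 * b2))" using T Dsq by (intro mult_left_mono) auto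
      also have "\<dots> = D * (T * (1 + b2 * b2))" by simp
      also have "\<dots> \<le> D * (gY * (1 - 2 / Q))" using E2 D0 by simp
      finally show ?thesis using e by (simp add: a_def)
    qed
    have K8: "T * (D + e (Suc k) * al (Suc k)) \<le> D * (g8 * 1)"
    proof -
      have "T * (1 + b2 * b2) \<le> (g8 * (1 - b2)) * (1 + b2 * b2)"
      proof (intro mult_right_mono order_trans[OF E8] mult_left_mono)
        show "1 - b2 * (1 + b) \<le> 1 - b2" using bb by (simp add: algebra_simps)
      qed (use fb bb in auto)
      also have "\<dots> = g8 * ((1 - b2) * (1 + b2 * b2))" by simp
      also have "\<dots> \<le> g8 * 1"
      proof (rule mult_left_mono[OF _ fb(2)])
        have "b2 * b2 \<le> b2 * 1" using bb by (intro mult_left_mono) auto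
        moreover have "0 \<le> b2 * (b2 * b2)" using bb by simp
        ultimately show "(1 - b2) * (1 + b2 * b2) \<le> 1" by (simp add: algebra_simps)
      qed
      finally have *: "T * (1 + b2 * b2) \<le> g8 * 1" .
      have "T * (D + a) \<le> T * (D * (1 + b2 * b2))" using T Dsq by (intro mult_left_mono) auto
      also have "\<dots> = D * (T * (1 + b2 * b2))" by simp
      also have "\<dots> \<le> D * (g8 * 1)" using * D0 by simp
      finally show ?thesis using e by (simp add: a_def)
    qed
    have Kmm: "T * (D + e (Suc k) * al (Suc k)) \<le> D * (g * (1 + a))" if "T \<le> g" for g
    proof -
      have "1 \<le> D" using den_gt_one[of k] by (simp add: D_def)
      then have "D + a \<le> D * (1 + a)" using a mult_right_mono[of 1 D a] by (simp add: algebra_simps)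
      then have "T * (D + a) \<le> g * (D * (1 + a))"
        using T that a D0 by (intro mult_mono) auto
      then show ?thesis using e by (simp add: a_def mult_ac)
    qed
    show ?thesis
    proof (cases "odd (n k)")
      case odd: True
      have DY: "D * Y (Suc k) = 1 + y" using DYo[OF odd] e by simp
      show ?thesis
      proof (intro conjI)
        show "T * (1 + al (Suc k) * B (Suc k)) \<le> (1 + B (Suc k) + Y (Suc k)) * (1 - a + zz)"
          by (rule vertex_Suc_mult[OF D_def _ _ _ fb(1) fb(3) K2, where X = "D + 2 + y"])
            (use DB' DY y DYb al(6) a bb in \<open>auto simp: distrib_left right_diff_distrib\<close>)
        show "T * (1 + al (Suc k) * B (Suc k)) \<le> (1 + B (Suc k) - Y (Suc k)) * (1 - a - zz)"
          by (rule vertex_Suc_mult[OF D_def _ _ al(6) fb(1) fb(3) K2, where X = "D - y"])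
            (use DB' DY y DYb a bb in \<open>auto simp: distrib_left right_diff_distrib\<close>)
        show "T * (1 + al (Suc k) * B (Suc k)) \<le> (1 - B (Suc k) + Y (Suc k)) * (1 + a - zz)"
          by (rule vertex_Suc_mult[OF D_def _ _ _ fb(2) _ K8, where X = "D + y"])
            (use DB' DY y D8 a bb in \<open>auto simp: distrib_left right_diff_distrib\<close>)
        show "T * (1 + al (Suc k) * B (Suc k)) \<le> (1 - B (Suc k) - Y (Suc k)) * (1 + a + zz)"
          by (rule vertex_Suc_mult[OF D_def _ _ _ fb(4) _ Kmm[OF tb(5)], where X = "D - 2 - y"])
            (use DB' DY y D6[OF odd] a bb in \<open>auto simp: distrib_left right_diff_distrib\<close>)
      qed
    next
      case False
      then have even: "even (n k)" by simp
      have DY: "D * Y (Suc k) = - y" using DYe[OF even] e by simp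
      show ?thesis
      proof (intro conjI)
        show "T * (1 + al (Suc k) * B (Suc k)) \<le> (1 + B (Suc k) + Y (Suc k)) * (1 - a + zz)"
          by (rule vertex_Suc_mult[OF D_def _ _ _ fb(1) fb(3) K2, where X = "D + 1 - y"])
            (use DB' DY y DYb al(6) a bb in \<open>auto simp: distrib_left right_diff_distrib\<close>)
        show "T * (1 + al (Suc k) * B (Suc k)) \<le> (1 + B (Suc k) - Y (Suc k)) * (1 - a - zz)"
          by (rule vertex_Suc_mult[OF D_def _ _ al(6) fb(1) fb(3) K2, where X = "D + 1 + y"])
            (use DB' DY y DYb a bb in \<open>auto simp: distrib_left right_diff_distrib\<close>)
        show "T * (1 + al (Suc k) * B (Suc k)) \<le> (1 - B (Suc k) + Y (Suc k)) * (1 + a - zz)"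
          by (rule vertex_Suc_mult[OF D_def _ _ _ fb(2) _ K8, where X = "D - 1 - y"])
            (use DB' DY y D8 a bb in \<open>auto simp: distrib_left right_diff_distrib\<close>)
        show "T * (1 + al (Suc k) * B (Suc k)) \<le> (1 - B (Suc k) - Y (Suc k)) * (1 + a + zz)"
          by (rule vertex_Suc_mult[OF D_def _ _ _ fb(2) _ Kmm[OF tb(4)], where X = "D - 1 + y"])
            (use DB' DY y D8 a bb in \<open>auto simp: distrib_left right_diff_distrib\<close>)
      qed
    qed
  next
    case False
    then have e: "e (Suc k) = - 1" using e_cases[of "Suc k"] by auto
    have DB': "D * B (Suc k) = - 1" using DB e by simp
    have Km: "T * (D + e (Suc k) * al (Suc k)) \<le> D * g" if "T \<le> g" for g
      using TD TDg[OF that] e by (simp add: a_def)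
    have tight: "T * (1 + al (Suc k) * B (Suc k)) \<le> x * y'"
      if "D * x = X" and "T * (D - a) \<le> X * y'" for x y' X
    proof -
      have "D * (T * (1 + al (Suc k) * B (Suc k))) = T * (D + al (Suc k) * (D * B (Suc k)))"
        by (simp add: algebra_simps)
      also have "\<dots> \<le> D * (x * y')" using that(2) unfolding that(1)[symmetric] DB' by (simp add: a_def mult_ac)
      finally show ?thesis using D0 by simp
    qed
    show ?thesis
    proof (cases "odd (n k)")
      case odd: True
      have DY: "D * Y (Suc k) = - 1 - y" using DYo[OF odd] e by simp
      show ?thesis
      proof (intro conjI)
        show "T * (1 + al (Suc k) * B (Suc k)) \<le> (1 + B (Suc k) + Y (Suc k)) * (1 - a + zz)"
        proof (cases "odd (n (Suc k))")
          case o: True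
          show ?thesis
            by (rule vertex_Suc_mult[OF D_def _ _ al(4)[OF o] fb(4) fb(5) Km[OF E6], where X = "D - 2 - y"])
              (use DB' DY y D6[OF odd] a bb in \<open>auto simp: distrib_left right_diff_distrib\<close>)
        next
          case o: False
          have aS: "a \<le> 1 / S" using al(3) o by simp
          have X1: "0 \<le> D - 2 - y" using D6[OF odd] fb(4) D0 y mult_nonneg_nonneg[of D g6] by linarith
          have "T * (D - a) \<le> (D - 2 - y) * (1 - a)"
            using tight_pp[OF k odd a(1) aS] by (simp add: D_def y_def)
          also have "\<dots> \<le> (D - 2 - y) * (1 - a + zz)" using X1 a by (intro mult_left_mono) auto
          finally show ?thesis
            by (intro tight[where X = "D - 2 - y"]) (use DB' DY in \<open>auto simp: distrib_left\<close>)
        qed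
        show "T * (1 + al (Suc k) * B (Suc k)) \<le> (1 + B (Suc k) - Y (Suc k)) * (1 - a - zz)"
          by (rule vertex_Suc_mult[OF D_def _ _ al(6) fb(1) fb(3) Km[OF tb(1)], where X = "D + y"])
            (use DB' DY y DYb a bb in \<open>auto simp: distrib_left right_diff_distrib\<close>)
        show "T * (1 + al (Suc k) * B (Suc k)) \<le> (1 - B (Suc k) + Y (Suc k)) * (1 + a - zz)"
          by (rule vertex_Suc_mult[OF D_def _ _ _ fb(1) _ Km, where X = "D - y" and h = 1])
            (use DB' DY y DYb a bb tb in \<open>auto simp: distrib_left right_diff_distrib\<close>)
        show "T * (1 + al (Suc k) * B (Suc k)) \<le> (1 - B (Suc k) - Y (Suc k)) * (1 + a + zz)"
          by (rule vertex_Suc_mult[OF D_def _ _ _ _ _ Km, where X = "D + 2 + y" and g = 1 and h = 1])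
            (use DB' DY y a bb tb in \<open>auto simp: distrib_left right_diff_distrib\<close>)
      qed
    next
      case False
      then have even: "even (n k)" by simp
      have DY: "D * Y (Suc k) = y" using DYe[OF even] e by simp
      show ?thesis
      proof (intro conjI)
        show "T * (1 + al (Suc k) * B (Suc k)) \<le> (1 + B (Suc k) + Y (Suc k)) * (1 - a + zz)"
        proof (rule vertex_Suc_mult[OF D_def _ _ _ fb(2) fb(6) Km[OF E8], where X = "D - 1 + y"])
          have "b2 \<le> b2 * (1 + b)" using bb by simp
          then show "1 - b2 * (1 + b) \<le> 1 - a + zz" using al(1) a by linarith
        qed (use DB' DY y D8 a bb in \<open>auto simp: distrib_left right_diff_distrib\<close>)
        show "T * (1 + al (Suc k) * B (Suc k)) \<le> (1 + B (Suc k) - Y (Suc k)) * (1 - a - zz)"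
        proof (cases "even (n (Suc k))")
          case o: True
          show ?thesis
            by (rule vertex_Suc_mult[OF D_def _ _ al(5)[OF o] fb(2) fb(6) Km[OF E8], where X = "D - 1 - y"])
              (use DB' DY y D8 a bb in \<open>auto simp: distrib_left right_diff_distrib\<close>)
        next
          case o: False
          have aQ: "a \<le> 1 / Q" using al(2) o by simp
          have X1: "0 \<le> D - 1 - y" using D8 fb(2) D0 y mult_nonneg_nonneg[of D g8] by linarith
          have "T * (D - a) \<le> (D - 1 - y) * (1 - 2 * a)"
            using tight_pm[OF k even a(1) aQ] by (simp add: D_def y_def)
          also have "\<dots> \<le> (D - 1 - y) * (1 - a - zz)" using X1 a by (intro mult_left_mono) auto
          finally show ?thesis
            by (intro tight[where X = "D - 1 - y"]) (use DB' DY in \<open>auto simp: distrib_left right_diff_distrib\<close>)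
        qed
        show "T * (1 + al (Suc k) * B (Suc k)) \<le> (1 - B (Suc k) + Y (Suc k)) * (1 + a - zz)"
          by (rule vertex_Suc_mult[OF D_def _ _ _ _ _ Km, where X = "D + 1 + y" and g = 1 and h = 1])
            (use DB' DY y a bb tb in \<open>auto simp: distrib_left right_diff_distrib\<close>)
        show "T * (1 + al (Suc k) * B (Suc k)) \<le> (1 - B (Suc k) - Y (Suc k)) * (1 + a + zz)"
          by (rule vertex_Suc_mult[OF D_def _ _ _ _ _ Km, where X = "D + 1 - y" and g = 1 and h = 1])
            (use DB' DY y a bb tb in \<open>auto simp: distrib_left right_diff_distrib\<close>)
      qed
    qed
  qed
  then show ?thesis unfolding vertices_ge_def a_def zz_def by simp
qed

end

end

section \<open>Reduction of the conditions to polynomial inequalities in the least digit\<close>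

lemma le_of_cross_mult:
  fixes l r N M :: real
  assumes "r - l = N / M" and "0 \<le> N" and "0 < M"
  shows "l \<le> r"
proof -
  have "0 \<le> N / M" using assms by simp
  then show ?thesis using assms(1) by linarith
qed

context cell_chain
begin

text \<open>The auxiliary quantities come from clearing denominators: \<open>b = 1 / x\<close>,
  \<open>b2 = x / d\<close>, \<open>Q = p / x\<close>, \<open>S = s / x\<close>,
  \<open>Yb = x / g\<close>. Each condition then asks for the nonnegativity of a polynomial
  expression.\<close>

lemma vertices_ge_rational:
  fixes R Ev Od x d p s g RR Tn :: real
  assumes n_R: "\<And>k. k \<ge> k0 \<Longrightarrow> R \<le> n k"
    and n_Od: "\<And>k. k \<ge> k0 \<Longrightarrow> odd (n k) \<Longrightarrow> Od \<le> n k"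
    and n_Ev: "\<And>k. k \<ge> k0 \<Longrightarrow> even (n k) \<Longrightarrow> Ev \<le> n k"
    and R4: "4 \<le> R" and Od5: "5 \<le> Od" and Ev4: "4 \<le> Ev"
    and x: "x = R - 1" and d: "d = R * x - 1" and p: "p = Od * x - 1" and s: "s = Ev * x - 1"
    and g: "g = p - 2 * x" and RR: "0 < RR" and g0: "0 < g" and Tn: "0 \<le> Tn"
    and E2: "0 \<le> (g * d - x * x) * (p - 2 * x) * d * RR - Tn * (d * d + x * x) * g * p"
    and E6: "0 \<le> (g * p - (2 * g + x) * x) * (d - 1) * RR - Tn * g * p * d"
    and E8: "0 \<le> (g * d - (g + x) * x) * (d - x - 1) * RR - Tn * g * d * d"
    and C1: "0 \<le> (g - x) * (s - x) * RR - Tn * g * s"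
    and G1: "0 \<le> ((Od - 2) * g * p - x * x) * (s - x) * RR - Tn * g * (Od * p * s + x * s - x * p)"
    and G1_neg: "0 \<le> ((Od - 2) * g * d - x * (g + x)) * (s - x) * RR - Tn * g * (Od * d * s - x * s - x * d)"
    and G2: "0 \<le> ((Ev - 1) * g * p - x * x) * (p - 2 * x) * RR - Tn * Ev * g * p * p"
    and G2_pos: "0 \<le> ((Ev - 1) * g * d + x * (g - x)) * (p - 2 * x) * RR - Tn * g * (Ev * d * p + x * p - x * d)"
    and G2_neg: "0 \<le> ((Ev - 1) * g * d - x * (g + x)) * (p - 2 * x) * RR - Tn * g * (Ev * d * p - x * p - x * d)"
    and b2_Q: "0 \<le> 2 * x * d - (x + 1) * p"
    and k: "k0 + 5 \<le> k"
  shows "vertices_ge (Tn / RR) k"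
proof -
  obtain j where j: "k = Suc j" "k0 + 4 \<le> j" using k by (cases k) auto
  have x0: "0 < x" "3 \<le> x" using R4 x by auto
  have "4 * 3 \<le> R * x" "5 * 3 \<le> Od * x" "4 * 3 \<le> Ev * x" using R4 Od5 Ev4 x0 by (intro mult_mono; simp)+
  then have pos: "0 < x" "0 < d" "0 < p" "0 < s" "0 < g" "0 < RR"
    using x0 d p s g0 RR by auto
  show ?thesis unfolding j(1)
  proof (rule vertices_ge_large[OF n_R n_Od n_Ev R4 Od5 Ev4, where b = "1 / x" and ?b2.0 = "x / d"
      and Q = "p / x" and S = "s / x" and Yb = "x / g"])
    show "1 / x = 1 / (R - 1)" by (simp add: x)
    show "x / d = 1 / (R - 1 / x)" using pos by (simp add: d field_simps)
    show "p / x = Od - 1 / x" using pos by (simp add: p field_simps)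
    show "s / x = Ev - 1 / x" using pos by (simp add: s field_simps)
    show "x / g = 1 / (p / x - 2)" using pos by (simp add: g field_simps)
    show "0 \<le> Tn / RR" using pos Tn by simp
    show "Tn / RR * (1 + x / d * (x / d)) \<le> (1 - x / g * (x / d)) * (1 - 2 / (p / x))"
      by (rule le_of_cross_mult[OF _ E2, of _ _ "RR * d * d * g * p"]) (use pos in \<open>simp_all add: field_simps\<close>)
    show "Tn / RR \<le> (1 - (2 + x / g) / (p / x)) * (1 - 1 / x * (x / d))"
      by (rule le_of_cross_mult[OF _ E6, of _ _ "RR * g * p * d"]) (use pos in \<open>simp_all add: field_simps\<close>)
    show "Tn / RR \<le> (1 - (1 + x / g) * (x / d)) * (1 - x / d * (1 + 1 / x))"
      by (rule le_of_cross_mult[OF _ E8, of _ _ "RR * g * d * d"]) (use pos in \<open>simp_all add: field_simps\<close>)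
    show "Tn / RR \<le> (1 - x / g) * (1 - 1 / (s / x))"
      by (rule le_of_cross_mult[OF _ C1, of _ _ "RR * g * s"]) (use pos in \<open>simp_all add: field_simps\<close>)
    show "Tn / RR * (Od + 1 / (p / x) - 1 / (s / x)) \<le> (Od - 2 - x / g / (p / x)) * (1 - 1 / (s / x))"
      by (rule le_of_cross_mult[OF _ G1, of _ _ "RR * g * p * s"]) (use pos in \<open>simp_all add: field_simps\<close>)
    show "Tn / RR * (Od - x / d - 1 / (s / x)) \<le> (Od - 2 - x / d * (1 + x / g)) * (1 - 1 / (s / x))"
      by (rule le_of_cross_mult[OF _ G1_neg, of _ _ "RR * g * d * s"]) (use pos in \<open>simp_all add: field_simps\<close>)
    show "Tn / RR * Ev \<le> (Ev - 1 - x / g / (p / x)) * (1 - 2 / (p / x))"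
      by (rule le_of_cross_mult[OF _ G2, of _ _ "RR * g * p * p"]) (use pos in \<open>simp_all add: field_simps\<close>)
    show "Tn / RR * (Ev + x / d - 1 / (p / x)) \<le> (Ev - 1 + x / d * (1 - x / g)) * (1 - 2 / (p / x))"
      by (rule le_of_cross_mult[OF _ G2_pos, of _ _ "RR * g * d * p"]) (use pos in \<open>simp_all add: field_simps\<close>)
    show "Tn / RR * (Ev - x / d - 1 / (p / x)) \<le> (Ev - 1 - x / d * (1 + x / g)) * (1 - 2 / (p / x))"
      by (rule le_of_cross_mult[OF _ G2_neg, of _ _ "RR * g * d * p"]) (use pos in \<open>simp_all add: field_simps\<close>)
    show "x / d * (1 + 1 / x) \<le> 2 / (p / x)"
      by (rule le_of_cross_mult[OF _ b2_Q, of _ _ "d * p"]) (use pos in \<open>simp_all add: field_simps\<close>)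
    show "k0 + 4 \<le> j" by (rule j)
  qed
qed

lemma vertices_ge_even:
  fixes m :: nat
  assumes n_m: "\<And>k. k \<ge> k0 \<Longrightarrow> int m \<le> n k" and m: "4 \<le> m" "even m" and k: "k0 + 5 \<le> k"
  shows "vertices_ge (1 - 3 / m + 4 / m ^ 2 - 7 / m ^ 3) k"
proof -
  \<comment> \<open>Written in \<open>t \<ge> 0\<close>, the distance from the smallest admissible
    digit, the polynomial conditions are settled by expansion.\<close>
  define t :: real where "t = real m - 4"
  have t: "0 \<le> t" using m by (simp add: t_def)
  have mt: "real m = 4 + t" by (simp add: t_def)
  have ge: "real m \<le> n j" if "j \<ge> k0" for j
    using n_m[OF that] by linarith
  have ge_odd: "real m + 1 \<le> n j" if "j \<ge> k0" "odd (n j)" for j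
  proof -
    have "even (int m) \<longleftrightarrow> even m" by simp
    then have "int m \<noteq> n j" using that(2) m by metis
    then have "int m + 1 \<le> n j" using n_m[OF that(1)] by linarith
    then show ?thesis by linarith
  qed
  have "vertices_ge ((real m ^ 3 - 3 * real m ^ 2 + 4 * real m - 7) / real m ^ 3) k"
    by (rule vertices_ge_rational[where ?k0.0 = k0 and R = m and Ev = m and Od = "real m + 1" and x = "3 + t"
      and d = "t * t + 7 * t + 11" and p = "t * t + 8 * t + 14" and s = "t * t + 7 * t + 11"
      and g = "t * t + 6 * t + 8"])
      (use k t ge ge_odd in \<open>simp_all add: mt algebra_simps power2_eq_square power3_eq_cube add_pos_nonneg add_nonneg_pos\<close>)
  also have "(real m ^ 3 - 3 * real m ^ 2 + 4 * real m - 7) / real m ^ 3 = 1 - 3 / m + 4 / m ^ 2 - 7 / m ^ 3"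
    using m by (simp add: field_simps power2_eq_square power3_eq_cube)
  finally show ?thesis .
qed

lemma vertices_ge_odd:
  fixes m :: nat
  assumes n_m: "\<And>k. k \<ge> k0 \<Longrightarrow> int m \<le> n k" and m: "5 \<le> m" "odd m" and k: "k0 + 5 \<le> k"
  shows "vertices_ge (1 - 3 / m + 3 / m ^ 2 - 6 / m ^ 3) k"
proof -
  define t :: real where "t = real m - 5"
  have t: "0 \<le> t" using m by (simp add: t_def)
  have mt: "real m = 5 + t" by (simp add: t_def)
  have ge: "real m \<le> n j" if "j \<ge> k0" for j
    using n_m[OF that] by linarith
  have ge_even: "real m + 1 \<le> n j" if "j \<ge> k0" "even (n j)" for j
  proof -
    have "even (int m) \<longleftrightarrow> even m" by simp
    then have "int m \<noteq> n j" using that(2) m by metis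
    then have "int m + 1 \<le> n j" using n_m[OF that(1)] by linarith
    then show ?thesis by linarith
  qed
  have "vertices_ge ((real m ^ 3 - 3 * real m ^ 2 + 3 * real m - 6) / real m ^ 3) k"
    by (rule vertices_ge_rational[where ?k0.0 = k0 and R = m and Ev = "real m + 1" and Od = m and x = "4 + t"
      and d = "t * t + 9 * t + 19" and p = "t * t + 9 * t + 19" and s = "t * t + 10 * t + 23"
      and g = "t * t + 7 * t + 11"])
      (use k t ge ge_even in \<open>simp_all add: mt algebra_simps power2_eq_square power3_eq_cube add_pos_nonneg add_nonneg_pos\<close>)
  also have "(real m ^ 3 - 3 * real m ^ 2 + 3 * real m - 6) / real m ^ 3 = 1 - 3 / m + 3 / m ^ 2 - 6 / m ^ 3"
    using m by (simp add: field_simps power2_eq_square power3_eq_cube)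
  finally show ?thesis .
qed

end

section \<open>The nearest integer continued fraction\<close>

lemma nint_dist_bounds:
  assumes "x \<notin> \<rat>"
  shows "nint_dist x \<notin> \<rat>" "0 < nint_dist x" "nint_dist x < 1 / 2"
proof -
  have "x - of_int (round x) \<notin> \<rat>"
  proof
    assume "x - of_int (round x) \<in> \<rat>"
    then have "x - of_int (round x) + of_int (round x) \<in> \<rat>" by (intro Rats_add) auto
    then show False using assms by simp
  qed
  then show irr: "nint_dist x \<notin> \<rat>"
    using Rats_minus_iff[of "x - of_int (round x)"] by (auto simp: nint_dist_def abs_if split: if_splits)
  have "nint_dist x \<noteq> 0" using irr by (metis Rats_0)
  then show "0 < nint_dist x" by (simp add: nint_dist_def)
  have "nint_dist x \<le> 1 / 2" unfolding nint_dist_def using of_int_round_abs_le[of x] by linarith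
  moreover have "nint_dist x \<noteq> 1 / 2" using irr by (metis Rats_divide Rats_1 Rats_number_of)
  ultimately show "nint_dist x < 1 / 2" by simp
qed

lemma nint_dist_not_frac:
  assumes "x \<notin> \<rat>" and "nint_dist x \<noteq> frac x"
  shows "x = of_int \<lceil>x\<rceil> - nint_dist x"
proof -
  have "x \<notin> \<int>" using assms(1) Ints_subset_Rats by blast
  then have c: "\<lceil>x\<rceil> = \<lfloor>x\<rfloor> + 1" by (simp add: ceiling_altdef) (metis Ints_of_int)
  have "round x \<noteq> \<lfloor>x\<rfloor>"
    using assms(2) by (auto simp: nint_dist_def frac_def)
  moreover have "round x = \<lfloor>x\<rfloor> \<or> round x = \<lfloor>x\<rfloor> + 1" unfolding round_def by linarith
  ultimately have "round x = \<lceil>x\<rceil>" using c by simp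
  moreover have "x \<le> of_int \<lceil>x\<rceil>" by simp
  ultimately show ?thesis by (simp add: nint_dist_def)
qed

lemma inverse_irrational: "(x :: real) \<notin> \<rat> \<Longrightarrow> 1 / x \<notin> \<rat>"
  using Rats_divide[OF Rats_1, of "1 / x"] by auto

locale nicf =
  fixes \<alpha> :: real
  assumes irrational: "\<alpha> \<notin> \<rat>" and pos: "0 < \<alpha>" and less_half: "\<alpha> < 1 / 2"
begin

abbreviation "a \<equiv> nicf_a \<alpha>"
abbreviation "eps \<equiv> nicf_eps \<alpha>"
abbreviation "rem \<equiv> nicf_rem \<alpha>"
abbreviation "lam \<equiv> nicf_lambda \<alpha>"

lemma rem_bounds: "rem k \<notin> \<rat> \<and> 0 < rem k \<and> rem k < 1 / 2"
proof (induction k)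
  case 0
  then show ?case using irrational pos less_half by simp
next
  case (Suc k)
  then have "1 / rem k \<notin> \<rat>" using inverse_irrational by blast
  then show ?case using nint_dist_bounds[of "1 / rem k"] by simp
qed

lemma inverse_rem: "1 / rem k = a (Suc k) + eps (Suc (Suc k)) * rem (Suc k)"
proof (cases "nint_dist (1 / rem k) = frac (1 / rem k)")
  case True
  then show ?thesis by (simp add: frac_def)
next
  case False
  then show ?thesis using nint_dist_not_frac[OF inverse_irrational False] rem_bounds[of k] by simp
qed

lemma eps_cases: "eps (Suc k) = 1 \<or> eps (Suc k) = - 1"
  by (cases k) auto

declare nicf_rem.simps(2) [simp del] nicf_a.simps(2) [simp del] nicf_eps.simps(3) [simp del]

lemma inverse_rem_gt_two: "2 < 1 / rem k"
  using rem_bounds[of k] by (simp add: field_simps)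

lemma a_ge_two: "2 \<le> a (Suc k)"
proof -
  have "real_of_int (a (Suc k)) > 2 - 1 / 2"
    using inverse_rem[of k] inverse_rem_gt_two[of k] rem_bounds[of "Suc k"] eps_cases[of "Suc k"] by auto
  then show ?thesis by linarith
qed

lemma a_two: "a (Suc k) = 2 \<Longrightarrow> eps (Suc (Suc k)) = 1"
  using inverse_rem[of k] inverse_rem_gt_two[of k] rem_bounds[of "Suc k"] eps_cases[of "Suc k"] by auto

lemma rem_mult_inverse: "rem k * a (Suc k) = 1 - eps (Suc (Suc k)) * (rem k * rem (Suc k))"
proof -
  have "rem k * (1 / rem k) = 1" using rem_bounds[of k] by simp
  then show ?thesis unfolding inverse_rem by (simp add: algebra_simps)
qed

definition P :: "nat \<Rightarrow> real" where
  "P k = (\<Prod>i<k. rem i)"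

lemma P_0: "P 0 = 1" and P_Suc: "P (Suc k) = rem k * P k"
  by (simp_all add: P_def)

lemma P_pos: "0 < P k"
  unfolding P_def using rem_bounds by (intro prod_pos) auto

definition delta :: "nat \<Rightarrow> real" where
  "delta k = nicf_q \<alpha> k * \<alpha> - nicf_p \<alpha> k"

lemma delta_Suc: "delta (Suc k) = - eps (Suc (Suc k)) * rem (Suc k) * delta k"
proof (induction k)
  case 0
  then show ?case using rem_mult_inverse[of 0] by (simp add: delta_def algebra_simps)
next
  case (Suc k)
  have ed': "rem (Suc k) * (eps (Suc (Suc k)) * delta k) = - delta (Suc k)"
    unfolding Suc by simp
  have "delta (Suc (Suc k)) = a (Suc (Suc k)) * delta (Suc k) + eps (Suc (Suc k)) * delta k"
    by (simp add: delta_def algebra_simps)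
  then have "rem (Suc k) * delta (Suc (Suc k)) = rem (Suc k) * a (Suc (Suc k)) * delta (Suc k) - delta (Suc k)"
    using ed' by (simp add: algebra_simps)
  also have "\<dots> = rem (Suc k) * (- eps (Suc (Suc (Suc k))) * rem (Suc (Suc k)) * delta (Suc k))"
    unfolding rem_mult_inverse by (simp add: algebra_simps)
  finally show ?case using rem_bounds[of "Suc k"] by (metis less_irrefl mult_cancel_left)
qed

lemma D_eq: "nicf_D \<alpha> k = P (Suc k)"
proof -
  have "\<bar>delta k\<bar> = P (Suc k)"
  proof (induction k)
    case 0
    then show ?case using pos by (simp add: delta_def P_Suc P_0)
  next
    case (Suc k)
    have "\<bar>delta (Suc k)\<bar> = rem (Suc k) * \<bar>delta k\<bar>"
      unfolding delta_Suc abs_mult using eps_cases[of "Suc k"] rem_bounds[of "Suc k"] by auto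
    then show ?case unfolding Suc by (simp add: P_Suc)
  qed
  then show ?thesis by (simp add: nicf_D_def delta_def)
qed

lemma P_add_le: "P (k + j) \<le> P k * (1 / 2) ^ j"
proof (induction j)
  case (Suc j)
  have "P (k + Suc j) = rem (k + j) * P (k + j)" by (simp add: P_Suc)
  also have "\<dots> \<le> 1 / 2 * (P k * (1 / 2) ^ j)"
    using Suc rem_bounds[of "k + j"] P_pos[of "k + j"] by (intro mult_mono) auto
  finally show ?case by simp
qed simp

lemma P_tendsto_0: "P \<longlonglongrightarrow> 0"
proof (rule real_tendsto_sandwich[of "\<lambda>_. 0" _ _ "\<lambda>k. (1 / 2) ^ k"])
  show "\<forall>\<^sub>F k in sequentially. P k \<le> (1 / 2) ^ k"
    using P_add_le[of 0] by (simp add: P_0)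
  show "\<forall>\<^sub>F k in sequentially. 0 \<le> P k" using P_pos by (simp add: less_imp_le)
  show "(\<lambda>k. (1 / 2 :: real) ^ k) \<longlonglongrightarrow> 0" by (rule LIMSEQ_realpow_zero) auto
qed simp

definition lamD :: "nat \<Rightarrow> real" where
  "lamD i = lam (Suc i) * P (Suc i)"

lemma abs_lamD_le: "\<bar>lamD (j + k)\<bar> \<le> P k * (1 / 2) ^ Suc j"
proof -
  have "\<bar>real_of_int (lam i)\<bar> \<le> 1" for i by (simp add: nicf_lambda_def power_abs)
  then have "\<bar>lamD (j + k)\<bar> \<le> 1 * P (Suc (j + k))"
    unfolding lamD_def abs_mult using P_pos[of "Suc (j + k)"] by (intro mult_mono) auto
  also have "\<dots> = P (k + Suc j)" by (simp add: add.commute)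
  also have "\<dots> \<le> P k * (1 / 2) ^ Suc j" by (rule P_add_le)
  finally show ?thesis .
qed

lemma half_sums: "(\<lambda>j. P k * (1 / 2) ^ Suc j) sums P k"
  using sums_mult[OF power_half_series, of "P k"] by simp

lemma summable_lamD_shift: "summable (\<lambda>j. lamD (j + k))"
  by (rule summable_comparison_test[OF _ sums_summable[OF half_sums[of k]]])
    (use abs_lamD_le in auto)

lemma summable_lamD: "summable lamD"
  using summable_lamD_shift[of 0] by simp

definition Lam :: real where "Lam = suminf lamD"

lemma gamma_star_eq: "2 * gamma_star \<alpha> = 1 + \<alpha> + Lam"
proof -
  \<comment> \<open>The telescoping sequence: \<open>a (Suc i) * P (Suc i) = P i - eps (Suc (Suc i))
    * P (Suc (Suc i))\<close> turns each summand without \<lambda> into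
    \<open>h i - h (Suc i)\<close>, and \<open>h 0 = 1 + \<alpha>\<close>.\<close>
  define h where "h i = P i + eps (Suc i) * P (Suc i)" for i
  have h0: "h \<longlonglongrightarrow> 0"
  proof -
    have "(\<lambda>i. \<bar>real_of_int (eps (Suc i)) * P (Suc i)\<bar>) \<longlonglongrightarrow> 0"
    proof -
      have "(\<lambda>i. \<bar>real_of_int (eps (Suc i)) * P (Suc i)\<bar>) = (\<lambda>i. P (Suc i))"
      proof
        fix i
        show "\<bar>real_of_int (eps (Suc i)) * P (Suc i)\<bar> = P (Suc i)"
          using eps_cases[of i] P_pos[of "Suc i"] by (auto simp: abs_mult)
      qed
      then show ?thesis using LIMSEQ_Suc[OF P_tendsto_0] by simp
    qed
    then have "(\<lambda>i. real_of_int (eps (Suc i)) * P (Suc i)) \<longlonglongrightarrow> 0"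
      by (rule tendsto_rabs_zero_cancel)
    from tendsto_add[OF P_tendsto_0 this] show ?thesis by (simp add: h_def[abs_def])
  qed
  have "(a (Suc i) - 1 + eps (Suc i)) * P (Suc i) = h i - h (Suc i)" for i
  proof -
    have "a (Suc i) * P (Suc i) = (rem i * a (Suc i)) * P i" by (simp add: P_Suc)
    also have "\<dots> = P i - eps (Suc (Suc i)) * P (Suc (Suc i))"
      unfolding rem_mult_inverse by (simp add: P_Suc algebra_simps)
    finally show ?thesis by (simp add: h_def algebra_simps)
  qed
  then have "(\<lambda>i. (a (Suc i) - 1 + eps (Suc i)) * P (Suc i)) sums (h 0 - 0)"
    using telescope_sums'[OF h0] by simp
  from sums_add[OF this summable_sums[OF summable_lamD]]
  have "(\<lambda>i. 1 / 2 * ((a (Suc i) - 1 + eps (Suc i)) * P (Suc i) + lamD i)) sums (1 / 2 * (h 0 + Lam))"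
    unfolding Lam_def by (intro sums_mult) simp
  moreover have "1 / 2 * ((a (Suc i) - 1 + eps (Suc i)) * P (Suc i) + lamD i) =
     1 / 2 * of_int (a (Suc i) - 1 + eps (Suc i) + lam (Suc i)) * nicf_D \<alpha> i" for i
    by (simp add: lamD_def D_eq algebra_simps)
  ultimately have "gamma_star \<alpha> = 1 / 2 * (h 0 + Lam)"
    unfolding gamma_star_def using sums_unique by (metis (no_types, lifting) suminf_cong)
  then show ?thesis by (simp add: h_def P_0 P_Suc)
qed

definition mu :: "nat \<Rightarrow> real" where
  "mu k = (- 1) ^ card {i \<in> {1..k}. odd (a i)}"

lemma mu_Suc: "mu (Suc k) = (if odd (a (Suc k)) then - mu k else mu k)"
proof -
  have "{i \<in> {1..Suc k}. odd (a i)} =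
      (if odd (a (Suc k)) then insert (Suc k) {i \<in> {1..k}. odd (a i)} else {i \<in> {1..k}. odd (a i)})"
    by (auto simp: le_Suc_eq)
  then show ?thesis by (simp add: mu_def)
qed

lemma mu_sq: "mu k * mu k = 1"
  by (simp add: mu_def flip: power_add mult_2)

lemma lam_eq: "lam (Suc k) = (if odd (a (Suc k)) then mu (Suc k) else 0)"
  by (simp add: nicf_lambda_def mu_def)

text \<open>The tail of \<open>Lam\<close> in units of \<open>P k\<close>. The next nonzero
  \<lambda> equals \<open>- mu k\<close>, so the prefactor makes the leading term of the alternating
  tail positive.\<close>

definition zt :: "nat \<Rightarrow> real" where
  "zt k = - mu k * (Lam - (\<Sum>i<k. lamD i)) / P k"

lemma zt_0: "zt 0 = - Lam"
  by (simp add: zt_def mu_def P_0)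

lemma zt_odd: "odd (a (Suc k)) \<Longrightarrow> zt k = rem k * (1 - zt (Suc k))"
proof -
  assume o: "odd (a (Suc k))"
  have r: "rem k \<noteq> 0" "P k \<noteq> 0" using rem_bounds[of k] P_pos[of k] by auto
  have "mu k * lamD k = - (mu k * mu k) * P (Suc k)"
    using o by (simp add: lamD_def lam_eq mu_Suc)
  then have ml: "mu k * lamD k = - P (Suc k)" by (simp add: mu_sq)
  have "rem k * (1 - zt (Suc k)) = rem k - (mu k * (Lam - (\<Sum>i<k. lamD i)) - mu k * lamD k) / P k"
    using o r by (simp add: zt_def mu_Suc P_Suc field_simps)
  also have "\<dots> = zt k" unfolding ml using r by (simp add: zt_def P_Suc field_simps)
  finally show ?thesis by simp
qed

lemma zt_even: "even (a (Suc k)) \<Longrightarrow> zt k = rem k * zt (Suc k)"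
  using rem_bounds[of k] by (simp add: zt_def mu_Suc P_Suc lamD_def lam_eq)

lemma abs_zt_le: "\<bar>zt k\<bar> \<le> 1"
proof -
  have tail: "Lam - (\<Sum>i<k. lamD i) = (\<Sum>j. lamD (j + k))"
    unfolding Lam_def by (rule suminf_minus_initial_segment[OF summable_lamD, symmetric])
  have "norm (\<Sum>j. lamD (j + k)) \<le> (\<Sum>j. P k * (1 / 2) ^ Suc j)"
    by (rule norm_suminf_le[OF _ sums_summable[OF half_sums]]) (use abs_lamD_le in auto)
  also have "\<dots> = P k" using half_sums by (rule sums_unique[symmetric])
  finally have "\<bar>Lam - (\<Sum>i<k. lamD i)\<bar> \<le> P k" unfolding tail by simp
  moreover have "\<bar>mu k\<bar> = 1" by (simp add: mu_def power_abs)
  ultimately show ?thesis using P_pos[of k] by (simp add: zt_def abs_mult abs_divide)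
qed

text \<open>Both branches of the recursion map the unit interval into itself and halve the distance to it.\<close>

lemma zt_unit: "0 \<le> zt k \<and> zt k \<le> 1"
proof -
  have bd: "- ((1 / 2) ^ m) \<le> zt k \<and> zt k \<le> 1 + (1 / 2) ^ m" for m k
  proof (induction m arbitrary: k)
    case 0
    then show ?case using abs_zt_le[of k] by auto
  next
    case (Suc m)
    define y where "y = (if odd (a (Suc k)) then 1 - zt (Suc k) else zt (Suc k))"
    define h :: real where "h = (1 / 2) ^ m"
    have y: "- h \<le> y" "y \<le> 1 + h" using Suc[of "Suc k"] by (auto simp: y_def h_def)
    have zy: "zt k = rem k * y" using zt_odd zt_even by (simp add: y_def)
    have h: "0 \<le> h" by (simp add: h_def)
    have "rem k * y \<le> 1 / 2 * (1 + h)"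
    proof (cases "0 \<le> y")
      case True
      then show ?thesis using y rem_bounds[of k] by (intro mult_mono) auto
    next
      case False
      then have "rem k * y \<le> 0" using rem_bounds[of k] by (simp add: mult_le_0_iff)
      also have "0 \<le> 1 / 2 * (1 + h)" using h by simp
      finally show ?thesis .
    qed
    moreover have "rem k * (- y) \<le> 1 / 2 * h"
    proof (cases "0 \<le> - y")
      case True
      then show ?thesis using y rem_bounds[of k] by (intro mult_mono) auto
    next
      case False
      then have "rem k * (- y) \<le> 0" using rem_bounds[of k] by (simp add: mult_le_0_iff)
      also have "0 \<le> 1 / 2 * h" using h by simp
      finally show ?thesis .
    qed
    ultimately show ?case unfolding zy by (simp add: h_def)
  qed
  have lim: "(\<lambda>m. (1 / 2 :: real) ^ m) \<longlonglongrightarrow> 0" by (rule LIMSEQ_realpow_zero) auto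
  have "- 0 \<le> zt k" by (rule LIMSEQ_le_const2[OF tendsto_minus[OF lim]]) (use bd in auto)
  moreover have "zt k \<le> 1 + 0" by (rule LIMSEQ_le_const[OF tendsto_add[OF tendsto_const lim]]) (use bd in auto)
  ultimately show ?thesis by simp
qed

lemma zt_bounds: "0 \<le> zt k" "zt k \<le> rem k"
proof -
  define y where "y = (if odd (a (Suc k)) then 1 - zt (Suc k) else zt (Suc k))"
  have y: "y \<le> 1" using zt_unit[of "Suc k"] by (auto simp: y_def)
  have zy: "zt k = rem k * y" using zt_odd zt_even by (simp add: y_def)
  show "zt k \<le> rem k" unfolding zy using y rem_bounds[of k] by simp
qed (use zt_unit in simp)

primrec cell_B :: "nat \<Rightarrow> real" where
  "cell_B 0 = 0"
| "cell_B (Suc k) = eps (Suc (Suc k)) / (a (Suc k) + cell_B k)"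

primrec cell_Y :: "nat \<Rightarrow> real" where
  "cell_Y 0 = 0"
| "cell_Y (Suc k) = (if odd (a (Suc k)) then eps (Suc (Suc k)) * (1 + cell_Y k)
     else - eps (Suc (Suc k)) * cell_Y k) / (a (Suc k) + cell_B k)"

sublocale cell_chain "\<lambda>k. a (Suc k)" "\<lambda>k. eps (Suc k)" rem zt cell_B cell_Y
proof
  show "1 / rem k = real_of_int (a (Suc k)) + real_of_int (eps (Suc (Suc k))) * rem (Suc k)" for k
    by (rule inverse_rem)
qed (use a_ge_two eps_cases a_two rem_bounds zt_odd zt_even zt_bounds in auto)

end

text \<open>The nested fraction disappears because \<open>theta * theta = 1 - 3 * theta\<close>
  makes \<open>theta * theta / (1 - theta)\<close> equal to
  \<open>(1 - 2 * theta) / 3\<close>.\<close>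

lemma bound_three_eq:
  "bound_three = 1 / 3 * (2 - sqrt 3) * (4 + theta) / (9 + 2 * theta - sqrt 3)"
proof -
  define t where "t = sqrt 3"
  define h where "h = theta"
  have h: "0 < h" "3 * h < 1" "h * h = 1 - 3 * h" using theta_bounds theta_sq by (auto simp: h_def)
  have "h\<^sup>2 / (1 - h) = (1 - 2 * h) / 3"
    using h by (simp add: field_simps power2_eq_square)
  then have b3: "bound_three = 1 / 4 * (2 - t) * ((1 - 1 / 4 * (1 + (1 - 2 * h) / 3)) / (1 + 1 / 4 * (h - (t - 1) / 2)))"
    unfolding bound_three_def theta_def[symmetric] Let_def h_def t_def by simp
  have u1: "1 - 1 / 4 * (1 + (1 - 2 * h) / 3) = (4 + h) / 6" by (simp add: field_simps)
  have u2: "1 + 1 / 4 * (h - (t - 1) / 2) = (9 + 2 * h - t) / 8" by (simp add: field_simps)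
  have "1 / 4 * A * (F / 6 / (G / 8)) = 1 / 3 * A * F / G" for A F G :: real by simp
  then show ?thesis unfolding b3 u1 u2 unfolding t_def h_def .
qed

section \<open>From the chain to the inhomogeneous minimum; closed forms of the constants\<close>

context nicf
begin

text \<open>An integer \<open>n\<close> and its nearest \<open>m\<close> give the odd point
  \<open>w = 1 - 2 * n\<close>, \<open>v = - 1 - 2 * m\<close>. The form there is twice the signed
  distance and \<open>\<bar>w\<bar>\<close> is about \<open>2 * \<bar>n\<bar>\<close>; together
  these produce the factor \<open>1 / 4\<close>.\<close>

lemma inhom_M_ge:
  assumes T: "0 \<le> T" and c: "0 < c"
    and ge: "\<And>w v :: int. odd w \<Longrightarrow> odd v \<Longrightarrow> \<bar>v - rem 0 * w + zt 0\<bar> < c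
      \<Longrightarrow> T \<le> \<bar>w\<bar> * \<bar>v - rem 0 * w + zt 0\<bar>"
  shows "inhom_M \<alpha> (gamma_star \<alpha>) \<ge> ereal (T / 4)"
  unfolding inhom_M_def le_Liminf_iff
proof (intro allI impI)
  fix y :: ereal
  assume y: "y < ereal (T / 4)"
  define F where "F = (\<lambda>n :: int. \<bar>of_int n\<bar> * nint_dist (of_int n * \<alpha> - gamma_star \<alpha>))"
  have F_eq: "\<exists>d. 0 \<le> d \<and> F n = \<bar>of_int n\<bar> * (d / 2) \<and> (d < c \<longrightarrow> T \<le> (2 * \<bar>of_int n\<bar> + 1) * d)" for n :: int
  proof -
    define m where "m = round (of_int n * \<alpha> - gamma_star \<alpha>)"
    define w where "w = 1 - 2 * n"
    define v where "v = - 1 - 2 * m"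
    define d where "d = \<bar>v - rem 0 * w + zt 0\<bar>"
    have "v - rem 0 * w + zt 0 = 2 * (of_int n * \<alpha> - gamma_star \<alpha> - of_int m)"
      using gamma_star_eq by (simp add: w_def v_def zt_0 algebra_simps)
    then have "d = \<bar>2\<bar> * \<bar>of_int n * \<alpha> - gamma_star \<alpha> - of_int m\<bar>"
      unfolding d_def by (simp only: abs_mult)
    then have "nint_dist (of_int n * \<alpha> - gamma_star \<alpha>) = d / 2"
      by (simp add: nint_dist_def m_def)
    moreover have "T \<le> (2 * \<bar>of_int n\<bar> + 1) * d" if "d < c"
    proof -
      have "T \<le> \<bar>w\<bar> * d" using ge[of w v] that by (auto simp: w_def v_def d_def)
      also have "\<dots> \<le> (2 * \<bar>of_int n\<bar> + 1) * d" by (intro mult_right_mono) (auto simp: w_def d_def)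
      finally show ?thesis .
    qed
    ultimately show ?thesis by (intro exI[of _ d]) (auto simp: F_def d_def)
  qed
  obtain r where r: "y \<le> ereal r" "r < T / 4"
  proof (cases y)
    case (real r)
    then show ?thesis using that[of r] y by simp
  next
    case PInf
    then show ?thesis using y by simp
  next
    case MInf
    then show ?thesis using that[of "T / 4 - 1"] by simp
  qed
  \<comment> \<open>\<open>2 * T / c\<close> serves the points where the form is at least
    \<open>c\<close>; \<open>T / (T / 4 - r)\<close> absorbs the summand 1 in
    \<open>2 * \<bar>n\<bar> + 1\<close>.\<close>
  have "\<exists>x0 :: real. 1 \<le> x0 \<and> 2 * T / c \<le> x0 \<and> T / (T / 4 - r) \<le> x0 "
    by (intro exI[of _ "max 1 (max (2 * T / c) (T / (T / 4 - r)))"] conjI) (simp_all add: le_max_iff_disj)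
  then obtain x0 :: real where x0: "1 \<le> x0" "2 * T / c \<le> x0" "T / (T / 4 - r) \<le> x0" by blast
  have big: "r < F n" if n: "x0 \<le> \<bar>of_int n\<bar>" for n
  proof -
    define x :: real where "x = \<bar>of_int n\<bar>"
    have x: "x0 \<le> x" "1 \<le> x" "0 < x" using n x0 by (auto simp: x_def)
    obtain d where d: "0 \<le> d" "F n = x * (d / 2)" "d < c \<longrightarrow> T \<le> (2 * x + 1) * d"
      using F_eq[of n] by (auto simp: x_def)
    show ?thesis
    proof (cases "d < c")
      case True
      define h where "h = T / 4 - r"
      have h: "0 < h" "r = T / 4 - h" using r by (auto simp: h_def)
      have "T \<le> x0 * h" using x0(3) h(1) unfolding h_def[symmetric] by (simp add: field_simps)
      also have "\<dots> \<le> x * h" using x h by simp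
      finally have Th: "T \<le> x * h" .
      have "(2 * x + 1) * (4 * r) = 2 * (x * T) + T - 8 * (x * h) - 4 * h"
        unfolding h(2) by (simp add: algebra_simps)
      also have "\<dots> < 2 * (x * T)" using Th h T by argo
      also have "\<dots> \<le> 2 * (x * ((2 * x + 1) * d))" using d True x by simp
      also have "\<dots> = (2 * x + 1) * (4 * (x * (d / 2)))" by simp
      finally have "4 * r < 4 * (x * (d / 2))" using x by simp
      then show ?thesis unfolding d(2) by linarith
    next
      case False
      have "T \<le> x0 * c / 2" using x0(2) c by (simp add: field_simps)
      also have "\<dots> \<le> x * c / 2" using x c by simp
      also have "\<dots> \<le> x * d / 2" using False x by simp
      finally show ?thesis using d r T by (simp add: field_simps)
    qed
  qed
  have "eventually (\<lambda>n :: int. \<lceil>x0\<rceil> \<le> \<bar>n\<bar>) (filtercomap (\<lambda>n::int. \<bar>n\<bar>) at_top)"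
    by (rule eventually_filtercomapI) (rule eventually_ge_at_top)
  then show "eventually (\<lambda>n. y < ereal (\<bar>of_int n\<bar> * nint_dist (of_int n * \<alpha> - gamma_star \<alpha>)))
      (filtercomap (\<lambda>n::int. \<bar>n\<bar>) at_top)"
  proof (eventually_elim)
    case (elim n)
    have "x0 \<le> real_of_int \<bar>n\<bar>" using elim by linarith
    then have "r < F n" using big by simp
    then have "ereal r < ereal (F n)" by simp
    then show ?case using r(1) unfolding F_def by (rule order.strict_trans1[rotated])
  qed
qed

lemma inhom_M_ge_of_vertices:
  assumes "0 \<le> T" and "\<And>k. k \<ge> K \<Longrightarrow> vertices_ge T k"
  shows "inhom_M \<alpha> (gamma_star \<alpha>) \<ge> ereal (T / 4)"
proof -
  obtain c where "0 < c" "\<And>w v. odd w \<Longrightarrow> odd v \<Longrightarrow> \<bar>real_of_int v - rem 0 * w + zt 0\<bar> < c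
      \<Longrightarrow> T \<le> \<bar>w\<bar> * \<bar>v - rem 0 * w + zt 0\<bar>"
    using product_ge_of_vertices_ge[OF assms(2)] by blast
  then show ?thesis using inhom_M_ge[OF assms(1)] by blast
qed

text \<open>The value of the vertices in the extremal case: future \<open>\<alpha> - z = c\<close>, past digits
  \<open>\<dots>, 3, 3, 3, 4\<close> with signs \<open>1\<close>, followed by \<open>\<epsilon> = -1\<close> and a digit \<open>3\<close>.\<close>

definition small_bound :: "real \<Rightarrow> real" where
  "small_bound c = 2 / 3 * (4 + theta) / ((3 - c) * (4 + theta) - 1) * (1 - c)"

lemma vertices_ge_small_bound:
  assumes c: "0 < c" "c \<le> 1 / 2" and H: "\<And>j. j \<ge> J \<Longrightarrow> rem j - zt j \<le> c" and k: "J + 3 \<le> k"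
  shows "vertices_ge (small_bound c) k"
proof -
  define E where "E = 3 - c"
  define f where "f = 4 + theta"
  define q where "q = E * f"
  \<comment> \<open>The solution of \<open>K_eq\<close>; its side conditions follow from
    \<open>4 \<le> f\<close> and \<open>5 / 2 * f \<le> q\<close>.\<close>
  define K where "K = 2 / 3 * f / (q - 1)"
  have E: "5 / 2 \<le> E" using c by (simp add: E_def)
  have f: "4 \<le> f" using theta_bounds by (simp add: f_def)
  have q: "5 / 2 * f \<le> q" unfolding q_def using E f by (intro mult_right_mono) auto
  have "q - 1 \<noteq> 0" using q f by simp
  then have K_eq: "K * (q - 1) = 2 / 3 * f"
    using nonzero_divide_eq_eq[of "q - 1" "2 / 3 * f" K] K_def by simp
  have "vertices_ge (K * (1 - c)) k"
  proof (rule vertices_ge_small[OF c _ _ _ _ _ H k])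
    show "0 < K" using q f by (simp add: K_def)
    show "K \<le> 3 / 10" using q f by (simp add: K_def field_simps)
    have KE: "K * E = 2 / 3 * q / (q - 1)" by (simp add: K_def q_def)
    show "1 / 4 \<le> 1 - K * (3 - c)" "1 - K * (3 - c) \<le> 1 / 3"
      unfolding E_def[symmetric] KE using q f by (simp_all add: field_simps)
    show "K * ((3 - c) * (4 + theta) - 1) = 2 / 3 * (4 + theta)"
      using K_eq by (simp add: q_def E_def f_def)
  qed
  then show ?thesis by (simp add: small_bound_def K_def q_def E_def f_def)
qed

lemma small_bound_pos: "0 < c \<Longrightarrow> c \<le> 1 / 2 \<Longrightarrow> 0 < small_bound c"
proof -
  assume c: "0 < c" "c \<le> 1 / 2"
  have "5 / 2 * 4 \<le> (3 - c) * (4 + theta)" using c theta_bounds by (intro mult_mono) auto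
  then show ?thesis using c theta_bounds by (simp add: small_bound_def)
qed

lemma vertices_ge_half: "k \<ge> 3 \<Longrightarrow> vertices_ge (small_bound (1 / 2)) k"
proof (rule vertices_ge_small_bound[of _ 0])
  fix j :: nat
  show "rem j - zt j \<le> 1 / 2" using rem_bounds[of j] zt_bounds[of j] by linarith
qed auto

text \<open>Membership would produce an odd point at which the form vanishes, against the positive
  lower bound obtained with \<open>c = 1 / 2\<close>.\<close>

lemma gamma_star_not_in_module: "\<not> (\<exists>k l :: int. gamma_star \<alpha> = of_int k + \<alpha> * of_int l)"
proof
  assume "\<exists>k l :: int. gamma_star \<alpha> = of_int k + \<alpha> * of_int l"
  then obtain k l :: int where kl: "gamma_star \<alpha> = of_int k + \<alpha> * of_int l" by blast
  obtain c where c: "0 < c" "\<And>w v. odd w \<Longrightarrow> odd v \<Longrightarrow> \<bar>real_of_int v - rem 0 * w + zt 0\<bar> < c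
      \<Longrightarrow> small_bound (1 / 2) \<le> \<bar>w\<bar> * \<bar>v - rem 0 * w + zt 0\<bar>"
    using product_ge_of_vertices_ge[OF vertices_ge_half] by blast
  have "real_of_int (2 * k - 1) - rem 0 * (1 - 2 * l) + zt 0 = 0"
    using gamma_star_eq kl by (simp add: zt_0 algebra_simps)
  then have "small_bound (1 / 2) \<le> 0" using c(2)[of "1 - 2 * l" "2 * k - 1"] c(1) by simp
  then show False using small_bound_pos[of "1 / 2"] by simp
qed

lemma inhom_rho_ge: "inhom_M \<alpha> (gamma_star \<alpha>) \<le> inhom_rho \<alpha>"
  unfolding inhom_rho_def using gamma_star_not_in_module by (intro SUP_upper) auto

lemma eventually_a_ge:
  fixes m :: nat
  assumes "nicf_R \<alpha> = ereal m"
  shows "\<exists>k0. \<forall>k\<ge>k0. int m \<le> a (Suc k)"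
proof -
  have "ereal (real m - 1) < liminf (\<lambda>i. ereal (of_int (a i)))"
    using assms unfolding nicf_R_def by simp
  from less_LiminfD[OF this] obtain k0 where k0: "\<And>k. k \<ge> k0 \<Longrightarrow> ereal (real m - 1) < ereal (of_int (a k))"
    unfolding eventually_sequentially by blast
  have "int m \<le> a (Suc k)" if "k \<ge> k0" for k
  proof -
    have "real m - 1 < of_int (a (Suc k))" using k0[of "Suc k"] that by simp
    then show ?thesis by linarith
  qed
  then show ?thesis by blast
qed

text \<open>\<open>2 - sqrt 3\<close> is the fixed point of the branch \<open>n = 4\<close>, \<open>\<epsilon> = -1\<close>; the excess of
  \<open>\<alpha> - z\<close> over it is at least halved from each level to the preceding one.\<close>

lemma rem_diff_zt_le:
  assumes n3: "\<And>k. k \<ge> k0 \<Longrightarrow> 3 \<le> a (Suc k)" and k: "k \<ge> k0"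
  shows "rem k - zt k \<le> 2 - sqrt 3"
proof -
  define c where "c = 2 - sqrt 3"
  have s3: "sqrt 3 * sqrt 3 = 3" by simp
  have "sqrt 3 < 7 / 4" by (rule real_less_lsqrt) (auto simp: power2_eq_square)
  moreover have "17 / 10 < sqrt 3" by (rule real_less_rsqrt) (auto simp: power2_eq_square)
  ultimately have c: "1 / 4 < c" "c < 3 / 10" by (auto simp: c_def)
  have cc: "c * c = 4 * c - 1" unfolding c_def using s3 by (simp add: algebra_simps)
  have step: "rem j - zt j - c \<le> 1 / 2 * h"
    if j: "j \<ge> k0" and h: "0 \<le> h" and IH: "rem (Suc j) - zt (Suc j) - c \<le> h" for j h
  proof -
    note rb = rem_bounds[of j] rem_bounds[of "Suc j"] and zb = zt_bounds[of "Suc j"]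
    define p where "p = a (Suc j) + eps (Suc (Suc j)) * rem (Suc j)"
    have rp: "rem j * p = 1" using rb unfolding p_def inverse_rem[symmetric] by simp
    show ?thesis
    proof (cases "odd (a (Suc j))")
      case True
      have "3 \<le> real_of_int (a (Suc j))" using n3[OF j] by simp
      then have "5 / 2 \<le> p" using rb eps_cases[of "Suc j"] by (auto simp: p_def)
      then have "rem j * (5 / 2) \<le> rem j * p" using rb by (intro mult_left_mono) auto
      then have "rem j \<le> 2 / 5" using rp by simp
      \<comment> \<open>At an odd digit \<open>rem j - zt j\<close> is this product, which stays
        well below \<open>c\<close>.\<close>
      then have "rem j * zt (Suc j) \<le> 2 / 5 * (1 / 2)" using rb zb by (intro mult_mono) auto
      then have "rem j - zt j \<le> 1 / 5" unfolding zt_odd[OF True] by (simp add: algebra_simps)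
      then show ?thesis using c h by simp
    next
      case False
      then have "a (Suc j) \<noteq> 3" by auto
      then have "4 \<le> a (Suc j)" using n3[OF j] by linarith
      then have p4: "4 - rem (Suc j) \<le> p" using rb eps_cases[of "Suc j"] by (auto simp: p_def)
      have "rem (Suc j) * c \<le> (zt (Suc j) + c + h) * c" using IH c by (intro mult_right_mono) auto
      also have "\<dots> \<le> zt (Suc j) + c * c + h"
      proof -
        have "zt (Suc j) * c \<le> zt (Suc j) * 1" "h * c \<le> h * 1" using c zb h by (intro mult_left_mono; simp)+
        then show ?thesis by (simp add: algebra_simps)
      qed
      finally have "1 - zt (Suc j) \<le> c * (4 - rem (Suc j)) + h" unfolding cc by (simp add: algebra_simps)
      also have "\<dots> \<le> c * p + h" using p4 c by simp
      finally have "rem j * (1 - zt (Suc j)) \<le> rem j * (c * p + h)" using rb by (intro mult_left_mono) auto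
      also have "\<dots> = c * (rem j * p) + rem j * h" by (simp add: algebra_simps)
      also have "\<dots> \<le> c + 1 / 2 * h" unfolding rp using mult_right_mono[of "rem j" "1 / 2" h] rb h by simp
      finally show ?thesis using zt_even[of j] False by (simp add: algebra_simps)
    qed
  qed
  have bd: "rem j - zt j - c \<le> (1 / 2) ^ m" if "j \<ge> k0" for m j
    using that
  proof (induction m arbitrary: j)
    case 0
    then show ?case using rem_bounds[of j] zt_bounds[of j] c by simp
  next
    case (Suc m)
    then show ?case using step[of j "(1 / 2) ^ m"] by simp
  qed
  have lim: "(\<lambda>m. (1 / 2 :: real) ^ m) \<longlonglongrightarrow> 0" by (rule LIMSEQ_realpow_zero) auto
  have "rem k - zt k - c \<le> 0" by (rule LIMSEQ_le_const[OF lim]) (use bd k in auto)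
  then show ?thesis by (simp add: c_def)
qed

lemma small_bound_half: "small_bound (1 / 2) / 4 = bound_two"
proof -
  have s: "sqrt 13 = 2 * theta + 3" by (simp add: theta_def field_simps)
  \<comment> \<open>With denominators cleared the claim reads
    \<open>(4 + theta) * (13 + 2 * theta) = 15 * (4 + theta) - 6\<close>.\<close>
  have "(4 + theta) * (13 + 2 * theta) = 52 + 21 * theta + 2 * (theta * theta)" by (simp add: algebra_simps)
  then have "(4 + theta) * (13 + 2 * theta) = 54 + 15 * theta" unfolding theta_sq by simp
  then show ?thesis unfolding small_bound_def bound_two_def s
    using theta_bounds by (simp add: field_simps)
qed

lemma small_bound_sqrt3: "small_bound (2 - sqrt 3) / 4 = bound_three"
proof -
  define t where "t = sqrt 3"
  have tt: "t * t = 3" by (simp add: t_def)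
  have "1 < t" unfolding t_def by (rule real_less_rsqrt) simp
  moreover have "t < 2" unfolding t_def by (rule real_less_lsqrt) auto
  ultimately have t: "1 < t" "t < 2" by auto
  define h where "h = theta"
  have h: "0 < h" "3 * h < 1" using theta_bounds by (auto simp: h_def)
  have b3': "bound_three = 1 / 3 * (2 - t) * (4 + h) / (9 + 2 * h - t)"
    using bound_three_eq by (simp add: t_def h_def)
  have "1 * 4 < (1 + t) * (4 + h)" using t h by (intro mult_strict_mono) auto
  then have d: "(1 + t) * (4 + h) - 1 \<noteq> 0" "9 + 2 * h - t \<noteq> 0" using t h by auto
  have "(t - 1) * (9 + 2 * h - t) = 10 * t + 2 * h * t - 9 - 2 * h - t * t" by (simp add: algebra_simps)
  moreover have "2 * (2 - t) * ((1 + t) * (4 + h) - 1) = 12 + 10 * t + 4 * h + 2 * h * t - 8 * (t * t) - 2 * h * (t * t)"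
    by (simp add: algebra_simps)
  ultimately have cross: "(t - 1) * (9 + 2 * h - t) = 2 * (2 - t) * ((1 + t) * (4 + h) - 1)"
    unfolding tt by simp
  have "2 / 3 * F / G * S / 4 = 1 / 6 * F * S / G" for F G S :: real by simp
  moreover have "3 - (2 - sqrt 3) = 1 + t" "1 - (2 - sqrt 3) = t - 1" by (simp_all add: t_def)
  ultimately have "small_bound (2 - sqrt 3) / 4 = 1 / 6 * (4 + h) * (t - 1) / ((1 + t) * (4 + h) - 1)"
    unfolding small_bound_def h_def by (simp only:)
  also have "\<dots> = bound_three"
    unfolding b3' frac_eq_eq[OF d] using cross by algebra
  finally show ?thesis .
qed

end

section \<open>Decimal values of the two constants\<close>

lemma bound_two_numeral: "27.211 \<le> 1 / bound_two" "1 / bound_two < 27.212"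
proof -
  have "36055 / 10000 < sqrt 13" by (rule real_less_rsqrt) (simp add: power2_eq_square)
  moreover have "sqrt 13 < 3606 / 1000" by (rule real_less_lsqrt) (simp_all add: power2_eq_square)
  ultimately show "27.211 \<le> 1 / bound_two" "1 / bound_two < 27.212" by (simp_all add: bound_two_def)
qed

lemma bound_three_numeral: "20.487 \<le> 1 / bound_three" "1 / bound_three < 20.488"
proof -
  define t where "t = sqrt 3"
  define s where "s = sqrt 13"
  have "3.60555 < s" unfolding s_def by (rule real_less_rsqrt) (simp add: power2_eq_square)
  moreover have "s < 3.60556" unfolding s_def by (rule real_less_lsqrt) (simp_all add: power2_eq_square)
  moreover have "1.73205 < t" unfolding t_def by (rule real_less_rsqrt) (simp add: power2_eq_square)
  moreover have "t < 1.732051" unfolding t_def by (rule real_less_lsqrt) (simp_all add: power2_eq_square)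
  ultimately have b: "3.60555 < s" "s < 3.60556" "1.73205 < t" "t < 1.732051" .
  define d where "d = (2 - t) * (5 + s)"
  have "d \<le> 0.26795 * 8.60556" unfolding d_def using b by (intro mult_mono) auto
  moreover have "0.267949 * 8.60555 \<le> d" unfolding d_def using b by (intro mult_mono) auto
  ultimately have d: "0 < d" "20.487 * d \<le> 6 * (6 + s - t)" "6 * (6 + s - t) < 20.488 * d" using b by auto
  have eq: "bound_three = d / (6 * (6 + s - t))"
    unfolding bound_three_eq theta_def d_def s_def t_def using b[unfolded s_def t_def] by (simp add: field_simps)
  have "1 / (d / N) = N / d" for N by simp
  then have inv: "1 / bound_three = 6 * (6 + s - t) / d" unfolding eq .
  show "20.487 \<le> 1 / bound_three" "1 / bound_three < 20.488"
    unfolding inv pos_le_divide_eq[OF d(1)] pos_divide_less_eq[OF d(1)] by (rule d)+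
qed

theorem theorem1:
  fixes \<alpha> :: real
  assumes "\<alpha> \<notin> \<rat>" and "0 < \<alpha>" and "\<alpha> < 1 / 2"
  shows "inhom_rho \<alpha> \<ge> inhom_M \<alpha> (gamma_star \<alpha>)
    \<and> (nicf_R \<alpha> = 2 \<longrightarrow> inhom_M \<alpha> (gamma_star \<alpha>) \<ge> ereal bound_two)
    \<and> (nicf_R \<alpha> = 3 \<longrightarrow> inhom_M \<alpha> (gamma_star \<alpha>) \<ge> ereal bound_three)
    \<and> (\<forall>R::nat. nicf_R \<alpha> = ereal (real R) \<and> R \<ge> 4 \<and> even R \<longrightarrow>
         inhom_M \<alpha> (gamma_star \<alpha>)
           \<ge> ereal (1 / 4 * (1 - 3 / real R + 4 / real R ^ 2 - 7 / real R ^ 3)))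
    \<and> (\<forall>R::nat. nicf_R \<alpha> = ereal (real R) \<and> R \<ge> 5 \<and> odd R \<longrightarrow>
         inhom_M \<alpha> (gamma_star \<alpha>)
           \<ge> ereal (1 / 4 * (1 - 3 / real R + 3 / real R ^ 2 - 6 / real R ^ 3)))
    \<and> 27.211 \<le> 1 / bound_two \<and> 1 / bound_two < 27.212
    \<and> 20.487 \<le> 1 / bound_three \<and> 1 / bound_three < 20.488"
proof -
  interpret nicf \<alpha> using assms by unfold_locales
  have two: "ereal bound_two \<le> inhom_M \<alpha> (gamma_star \<alpha>)"
    using inhom_M_ge_of_vertices[OF less_imp_le[OF small_bound_pos] vertices_ge_half]
    unfolding small_bound_half by simp
  have three: "ereal bound_three \<le> inhom_M \<alpha> (gamma_star \<alpha>)" if "nicf_R \<alpha> = 3"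
  proof -
    have "nicf_R \<alpha> = ereal (3 :: nat)" using that by (simp add: numeral_eq_ereal)
    then obtain k0 where "\<And>k. k \<ge> k0 \<Longrightarrow> int 3 \<le> a (Suc k)" using eventually_a_ge by blast
    then have H: "\<And>j. j \<ge> k0 \<Longrightarrow> rem j - zt j \<le> 2 - sqrt 3" using rem_diff_zt_le[of k0] by simp
    have "sqrt 3 < 2" by (rule real_less_lsqrt) auto
    moreover have "3 / 2 < sqrt 3" by (rule real_less_rsqrt) (simp add: power2_eq_square)
    ultimately have c: "0 < 2 - sqrt 3" "2 - sqrt 3 \<le> 1 / 2" by auto
    have "vertices_ge (small_bound (2 - sqrt 3)) k" if "k \<ge> k0 + 3" for k
      using vertices_ge_small_bound[OF c H that] .
    from inhom_M_ge_of_vertices[OF less_imp_le[OF small_bound_pos[OF c]] this]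
    show ?thesis unfolding small_bound_sqrt3 .
  qed
  have even: "ereal (1 / 4 * (1 - 3 / real R + 4 / real R ^ 2 - 7 / real R ^ 3)) \<le> inhom_M \<alpha> (gamma_star \<alpha>)"
    if R: "nicf_R \<alpha> = ereal (real R)" "R \<ge> 4" "even R" for R :: nat
  proof -
    obtain k0 where k0: "\<And>k. k \<ge> k0 \<Longrightarrow> int R \<le> a (Suc k)" using eventually_a_ge[OF R(1)] by blast
    have "3 / real R \<le> 3 / 4" using R by (intro divide_left_mono) auto
    moreover have "4 ^ 3 \<le> real R ^ 3" using R by (intro power_mono) auto
    then have "7 / real R ^ 3 \<le> 1 / 4" using R by (simp add: field_simps)
    moreover have "0 \<le> 4 / real R ^ 2" by simp
    ultimately have "0 \<le> 1 - 3 / real R + 4 / real R ^ 2 - 7 / real R ^ 3" by argo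
    from inhom_M_ge_of_vertices[OF this, of "k0 + 5"] vertices_ge_even[OF k0 R(2,3)]
    show ?thesis by simp
  qed
  have odd: "ereal (1 / 4 * (1 - 3 / real R + 3 / real R ^ 2 - 6 / real R ^ 3)) \<le> inhom_M \<alpha> (gamma_star \<alpha>)"
    if R: "nicf_R \<alpha> = ereal (real R)" "R \<ge> 5" "odd R" for R :: nat
  proof -
    obtain k0 where k0: "\<And>k. k \<ge> k0 \<Longrightarrow> int R \<le> a (Suc k)" using eventually_a_ge[OF R(1)] by blast
    have "3 / real R \<le> 3 / 5" using R by (intro divide_left_mono) auto
    moreover have "5 ^ 3 \<le> real R ^ 3" using R by (intro power_mono) auto
    then have "6 / real R ^ 3 \<le> 2 / 5" using R by (simp add: field_simps)
    moreover have "0 \<le> 3 / real R ^ 2" by simp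
    ultimately have "0 \<le> 1 - 3 / real R + 3 / real R ^ 2 - 6 / real R ^ 3" by argo
    from inhom_M_ge_of_vertices[OF this, of "k0 + 5"] vertices_ge_odd[OF k0 R(2,3)]
    show ?thesis by simp
  qed
  show ?thesis
    using inhom_rho_ge two three even odd bound_two_numeral bound_three_numeral by blast
qed

end
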